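(* Let $(G,r)$ be a connected locally finite network. Then $(G,r)$ is not in $\mathcal{O}_{HD}$ if and only if there are transient vertex-disjoint subnetworks $A$ and $B$ of $(G,r)$ such that the contraction $G/A/B$ admits a potential $\rho$ of finite energy with $\rho(A)\neq\rho(B)$.
   Context: A network is a pair $(G,r)$ where $G$ is an undirected multigraph and $r:E(G)\to\mathbb{R}_{>0}$ assigns a resistance to every edge; $c(e)=1/r(e)$ is the conductance. It is locally finite if every vertex of $G$ is incident with only finitely many edges. A subnetwork is a subgraph of $G$ together with the restriction of $r$ to its edges. A directed edge is a triple $\vec e=(e,x,y)$ with $e$ an edge with end-vertices $x\neq y$; $init(\vec e)=x$, $ter(\vec e)=y$, and its reverse is $\overleftarrow{e}=(e,y,x)$. A function $\varphi$ on directed edges is antisymmetric if $\varphi(\vec e)=-\varphi(\overleftarrow{e})$ for all $\vec e$. Its accumulation at a vertex $v$ is $\sum_{\vec e:\, ter(\vec e)=v}\varphi(\vec e)$, and it satisfies (K1) at $v$ if this is $0$. Its energy is $\sum_{e\in E} r(e)\varphi(\vec e)^2$ (one orientation per edge). A $v$-flow of intensity $I$ is an antisymmetric function having accumulation $I$ at $v$ and satisfying (K1) at every other vertex. A network is transient if for some vertex $v$ there is a $v$-flow of non-zero intensity with finite energy in it. A potential is a function $h:V(G)\to\mathbb{R}$; its energy is $\sum_{e=vw\in E(G)} (h(v)-h(w))^2/r(e)$. A potential $h$ is harmonic if for every vertex $v$ the value $h(v)$ is the average of the values of $h$ at its neighbours weighted by conductances, i.e. $\sum_{e=vw}c(e)(h(v)-h(w))=0$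 (sum over edges $e$ incident with $v$). A network is in $\mathcal{O}_{HD}$ if every harmonic function of finite energy on it is constant. $G/A/B$ denotes the graph obtained from $G$ by contracting each of the vertex sets of $A$ and $B$ to a single vertex (keeping parallel edges and resistances; it need not be locally finite); $\rho(A)$ and $\rho(B)$ denote the values of $\rho$ at the two contraction vertices. *)

theory Defs
  imports "HOL-Analysis.Analysis" "HOL-Library.Uprod"
begin

text \<open>
  Networks are undirected multigraphs with resistances. Parallel edges are distinct elements of
  the edge set with the same end pair; loops (end pair \<open>Upair x x\<close>) are allowed, since
  contractions produce them. The values of \<open>ends\<close> and \<open>res\<close> outside the edge set are irrelevant.
\<close>

record ('v, 'e) network =
  verts :: "'v set"
  edges :: "'e set"
  ends :: "'e \<Rightarrow> 'v uprod"
  res :: "'e \<Rightarrow> real"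

definition is_network :: "('v, 'e) network \<Rightarrow> bool" where
  "is_network N \<longleftrightarrow> (\<forall>e\<in>edges N. set_uprod (ends N e) \<subseteq> verts N \<and> res N e > 0)"

definition conductance :: "('v, 'e) network \<Rightarrow> 'e \<Rightarrow> real" where
  "conductance N e = 1 / res N e"

definition locally_finite :: "('v, 'e) network \<Rightarrow> bool" where
  "locally_finite N \<longleftrightarrow> (\<forall>v\<in>verts N. finite {e \<in> edges N. v \<in> set_uprod (ends N e)})"

definition adjacency :: "('v, 'e) network \<Rightarrow> ('v \<times> 'v) set" where
  "adjacency N = {(x, y). \<exists>e\<in>edges N. ends N e = Upair x y}"

definition connected_network :: "('v, 'e) network \<Rightarrow> bool" where
  "connected_network N \<longleftrightarrow>
     verts N \<noteq> {} \<and> (\<forall>x\<in>verts N. \<forall>y\<in>verts N. (x, y) \<in> (adjacency N)\<^sup>*)"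

definition subnetwork :: "('v, 'e) network \<Rightarrow> ('v, 'e) network \<Rightarrow> bool" where
  "subnetwork A N \<longleftrightarrow>
     is_network A \<and> verts A \<subseteq> verts N \<and> edges A \<subseteq> edges N \<and>
     (\<forall>e\<in>edges A. ends A e = ends N e \<and> res A e = res N e)"


subsection \<open>Flows and transience\<close>

type_synonym ('v, 'e) dedge = "'e \<times> 'v \<times> 'v"

definition init :: "('v, 'e) dedge \<Rightarrow> 'v" where
  "init = (\<lambda>(e, x, y). x)"

definition ter :: "('v, 'e) dedge \<Rightarrow> 'v" where
  "ter = (\<lambda>(e, x, y). y)"

definition rev_dedge :: "('v, 'e) dedge \<Rightarrow> ('v, 'e) dedge" where
  "rev_dedge = (\<lambda>(e, x, y). (e, y, x))"

definition dedges :: "('v, 'e) network \<Rightarrow> ('v, 'e) dedge set" where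
  "dedges N = {(e, x, y). e \<in> edges N \<and> ends N e = Upair x y \<and> x \<noteq> y}"

definition antisymmetric :: "('v, 'e) network \<Rightarrow> (('v, 'e) dedge \<Rightarrow> real) \<Rightarrow> bool" where
  "antisymmetric N \<phi> \<longleftrightarrow> (\<forall>d\<in>dedges N. \<phi> d = - \<phi> (rev_dedge d))"

text \<open>The following sum is finite, hence not a default value, when \<open>N\<close> is locally finite.\<close>

definition accumulation :: "('v, 'e) network \<Rightarrow> (('v, 'e) dedge \<Rightarrow> real) \<Rightarrow> 'v \<Rightarrow> real" where
  "accumulation N \<phi> v = (\<Sum>d \<in> {d \<in> dedges N. ter d = v}. \<phi> d)"

definition K1 :: "('v, 'e) network \<Rightarrow> (('v, 'e) dedge \<Rightarrow> real) \<Rightarrow> 'v \<Rightarrow> bool" where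
  "K1 N \<phi> v \<longleftrightarrow> accumulation N \<phi> v = 0"

definition is_flow ::
    "('v, 'e) network \<Rightarrow> 'v \<Rightarrow> real \<Rightarrow> (('v, 'e) dedge \<Rightarrow> real) \<Rightarrow> bool" where
  "is_flow N v I \<phi> \<longleftrightarrow>
     antisymmetric N \<phi> \<and> accumulation N \<phi> v = I \<and> (\<forall>u \<in> verts N - {v}. K1 N \<phi> u)"

text \<open>
  One orientation is chosen for each edge that is not a loop (loops have no orientation, so they
  carry no flow). For antisymmetric \<open>\<phi>\<close> the energy does not depend on the choice. Energies are
  sums of nonnegative terms, so having finite energy means that the terms are summable.
\<close>

definition orientation :: "('v, 'e) network \<Rightarrow> 'e \<Rightarrow> ('v, 'e) dedge" where
  "orientation N e = (SOME d. d \<in> dedges N \<and> fst d = e)"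

definition finite_flow_energy :: "('v, 'e) network \<Rightarrow> (('v, 'e) dedge \<Rightarrow> real) \<Rightarrow> bool" where
  "finite_flow_energy N \<phi> \<longleftrightarrow>
     (\<lambda>e. res N e * (\<phi> (orientation N e))\<^sup>2) summable_on
       {e \<in> edges N. proper_uprod (ends N e)}"

definition transient :: "('v, 'e) network \<Rightarrow> bool" where
  "transient N \<longleftrightarrow>
     (\<exists>v\<in>verts N. \<exists>I \<phi>. I \<noteq> 0 \<and> is_flow N v I \<phi> \<and> finite_flow_energy N \<phi>)"


subsection \<open>Potentials and harmonic functions\<close>

text \<open>Potentials are functions on the vertex type; only their values on \<open>verts N\<close> matter.\<close>

lift_definition sq_drop :: "('v \<Rightarrow> real) \<Rightarrow> 'v uprod \<Rightarrow> real" is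
  "\<lambda>h (v, w). (h v - h w)\<^sup>2"
  by (auto simp: power2_commute)

lemma sq_drop_Upair [simp]: "sq_drop h (Upair v w) = (h v - h w)\<^sup>2"
  by transfer simp

definition finite_potential_energy :: "('v, 'e) network \<Rightarrow> ('v \<Rightarrow> real) \<Rightarrow> bool" where
  "finite_potential_energy N h \<longleftrightarrow>
     (\<lambda>e. sq_drop h (ends N e) / res N e) summable_on edges N"

text \<open>
  The directed edges starting at \<open>v\<close> correspond to the edges at \<open>v\<close> other than loops; a loop
  would contribute zero to the sum.
\<close>

definition harmonic :: "('v, 'e) network \<Rightarrow> ('v \<Rightarrow> real) \<Rightarrow> bool" where
  "harmonic N h \<longleftrightarrow>
     (\<forall>v\<in>verts N.
        (\<Sum>d \<in> {d \<in> dedges N. init d = v}. conductance N (fst d) * (h v - h (ter d))) = 0)"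

definition O_HD :: "('v, 'e) network \<Rightarrow> bool" where
  "O_HD N \<longleftrightarrow>
     (\<forall>h. harmonic N h \<and> finite_potential_energy N h \<longrightarrow> (\<exists>c. \<forall>v\<in>verts N. h v = c))"


subsection \<open>Contraction\<close>

text \<open>
  Vertices of \<open>N/A/B\<close> are sets of vertices of \<open>N\<close>: the contraction vertices are \<open>verts A\<close> and
  \<open>verts B\<close>, and every other vertex \<open>v\<close> becomes \<open>{v}\<close>. Every edge is kept, with its resistance.
  The definition is meant for vertex-disjoint \<open>A\<close> and \<open>B\<close> with nonempty vertex sets.
\<close>

definition contract_vertex ::
    "('v, 'e) network \<Rightarrow> ('v, 'e) network \<Rightarrow> 'v \<Rightarrow> 'v set" where
  "contract_vertex A B v =
     (if v \<in> verts A then verts A else if v \<in> verts B then verts B else {v})"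

definition contraction ::
    "('v, 'e) network \<Rightarrow> ('v, 'e) network \<Rightarrow> ('v, 'e) network \<Rightarrow> ('v set, 'e) network" where
  "contraction N A B =
     \<lparr>verts = contract_vertex A B ` verts N,
      edges = edges N,
      ends = (\<lambda>e. map_uprod (contract_vertex A B) (ends N e)),
      res = res N\<rparr>"

end

theory Submission
  imports Defs
begin

text \<open>
  If \<open>u\<close> is a non-constant harmonic function of finite energy and \<open>p < q\<close> are two of its values,
  then the subnetworks induced on \<open>{u \<ge> q}\<close> and \<open>{u \<le> p}\<close> are transient, and clamping \<open>u\<close> to
  \<open>[p, q]\<close> gives the potential on the contraction.

  Conversely, a potential on the contraction is a potential \<open>h\<close> on the network that is constant
  on \<open>A\<close> and on \<open>B\<close>. Projecting its gradient in \<open>\<ell>\<^sup>2\<close> orthogonally to the gradients of finitely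
  supported functions leaves the gradient of a harmonic function, which is zero for networks in
  \<open>O_HD\<close>. So there are finitely supported \<open>f\<^sub>n\<close> such that the energy of \<open>h + f\<^sub>n\<close> tends to zero.
  A \<open>v\<close>-flow of intensity \<open>I\<close> in \<open>A\<close> pairs with the gradient of \<open>h + f\<^sub>n\<close> to \<open>I f\<^sub>n(v)\<close>, as
  \<open>h\<close> is constant on \<open>A\<close>; hence \<open>h + f\<^sub>n\<close> tends at \<open>v\<close> to the value of \<open>h\<close> on \<open>A\<close>, and likewise
  for \<open>B\<close>. As all differences of \<open>h + f\<^sub>n\<close> tend to zero, the two values agree.
\<close>

subsection \<open>Orthogonal projection in \<open>\<ell>\<^sup>2\<close>\<close>

definition l2_on :: "'a set \<Rightarrow> ('a \<Rightarrow> real) \<Rightarrow> bool" where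
  "l2_on S x \<longleftrightarrow> (\<lambda>e. (x e)\<^sup>2) summable_on S"

text \<open>\<open>infsum\<close> is 0 when the products are not summable, so the bilinearity lemmas
  below carry \<open>l2_on\<close> hypotheses.\<close>

definition l2_inner :: "'a set \<Rightarrow> ('a \<Rightarrow> real) \<Rightarrow> ('a \<Rightarrow> real) \<Rightarrow> real" where
  "l2_inner S x y = (\<Sum>\<^sub>\<infinity>e\<in>S. x e * y e)"

lemma l2_inner_cong:
  assumes "\<And>e. e \<in> S \<Longrightarrow> x e = x' e" "\<And>e. e \<in> S \<Longrightarrow> y e = y' e"
  shows "l2_inner S x y = l2_inner S x' y'"
  unfolding l2_inner_def by (intro infsum_cong) (simp add: assms)

lemma l2_on_cong: "(\<And>e. e \<in> S \<Longrightarrow> x e = x' e) \<Longrightarrow> l2_on S x \<longleftrightarrow> l2_on S x'"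
  unfolding l2_on_def by (intro summable_on_cong) simp

lemma l2_on_mult_summable:
  assumes "l2_on S x" "l2_on S y"
  shows "(\<lambda>e. x e * y e) summable_on S"
proof -
  have "(\<lambda>e. (x e)\<^sup>2 + (y e)\<^sup>2) summable_on S"
    using assms by (intro summable_on_add) (auto simp: l2_on_def)
  then have "(\<lambda>e. \<bar>x e * y e\<bar>) summable_on S"
  proof (rule summable_on_comparison_test)
    fix e
    show "\<bar>x e * y e\<bar> \<le> (x e)\<^sup>2 + (y e)\<^sup>2"
      using sum_squares_bound[of "\<bar>x e\<bar>" "\<bar>y e\<bar>"]
        mult_nonneg_nonneg[OF abs_ge_zero abs_ge_zero, of "x e" "y e"]
      unfolding abs_mult power2_abs by linarith
  qed simp
  then show ?thesis
    by (subst summable_on_iff_abs_summable_on_real) simp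
qed

lemma l2_on_lincomb:
  assumes "l2_on S x" "l2_on S y"
  shows "l2_on S (\<lambda>e. a * x e + b * y e)"
proof -
  have "(\<lambda>e. a\<^sup>2 * (x e)\<^sup>2 + 2 * a * b * (x e * y e) + b\<^sup>2 * (y e)\<^sup>2) summable_on S"
    using assms l2_on_mult_summable[OF assms]
    by (intro summable_on_add summable_on_cmult_right) (auto simp: l2_on_def)
  then show ?thesis
    by (simp add: l2_on_def power2_eq_square algebra_simps)
qed

lemma l2_on_add: "l2_on S x \<Longrightarrow> l2_on S y \<Longrightarrow> l2_on S (\<lambda>e. x e + y e)"
  using l2_on_lincomb[of S x y 1 1] by simp

lemma l2_on_diff: "l2_on S x \<Longrightarrow> l2_on S y \<Longrightarrow> l2_on S (\<lambda>e. x e - y e)"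
  using l2_on_lincomb[of S x y 1 "-1"] by simp

lemma l2_on_subset: "l2_on S x \<Longrightarrow> T \<subseteq> S \<Longrightarrow> l2_on T x"
  unfolding l2_on_def by (rule summable_on_subset_banach)

lemma l2_on_finite_support:
  assumes "finite {e \<in> S. x e \<noteq> 0}"
  shows "l2_on S x"
proof -
  have "(\<lambda>e. (x e)\<^sup>2) summable_on S \<longleftrightarrow> (\<lambda>e. (x e)\<^sup>2) summable_on {e \<in> S. x e \<noteq> 0}"
    by (intro summable_on_cong_neutral) auto
  with assms show ?thesis by (simp add: l2_on_def)
qed

lemma l2_inner_lincomb_left:
  assumes "l2_on S x" "l2_on S y" "l2_on S z"
  shows "l2_inner S (\<lambda>e. a * x e + b * y e) z = a * l2_inner S x z + b * l2_inner S y z"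
proof -
  have "l2_inner S (\<lambda>e. a * x e + b * y e) z
      = (\<Sum>\<^sub>\<infinity>e\<in>S. a * (x e * z e) + b * (y e * z e))"
    by (simp add: l2_inner_def algebra_simps)
  also have "\<dots> = (\<Sum>\<^sub>\<infinity>e\<in>S. a * (x e * z e)) + (\<Sum>\<^sub>\<infinity>e\<in>S. b * (y e * z e))"
    using assms by (intro infsum_add summable_on_cmult_right l2_on_mult_summable)
  finally show ?thesis by (simp add: l2_inner_def infsum_cmult_right')
qed

lemma l2_inner_commute: "l2_inner S x y = l2_inner S y x"
  by (simp add: l2_inner_def mult.commute)

lemma l2_inner_lincomb_right:
  assumes "l2_on S x" "l2_on S y" "l2_on S z"
  shows "l2_inner S z (\<lambda>e. a * x e + b * y e) = a * l2_inner S z x + b * l2_inner S z y"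
  using l2_inner_lincomb_left[OF assms] by (simp add: l2_inner_commute)

lemma l2_inner_self_nonneg: "l2_inner S x x \<ge> 0"
  unfolding l2_inner_def by (intro infsum_nonneg) auto

lemma l2_inner_self_lincomb:
  assumes "l2_on S x" "l2_on S y"
  shows "l2_inner S (\<lambda>e. a * x e + b * y e) (\<lambda>e. a * x e + b * y e)
    = a\<^sup>2 * l2_inner S x x + 2 * a * b * l2_inner S x y + b\<^sup>2 * l2_inner S y y"
  using assms
  by (simp add: l2_inner_lincomb_left l2_inner_lincomb_right l2_on_lincomb
      l2_inner_commute[of S y x] power2_eq_square algebra_simps)

lemma coordinate_le_l2_inner_self:
  assumes "l2_on S x" "e \<in> S"
  shows "(x e)\<^sup>2 \<le> l2_inner S x x"
  using finite_sum_le_infsum[of "\<lambda>e. (x e)\<^sup>2" S "{e}"] assms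
  by (simp add: l2_on_def l2_inner_def power2_eq_square)

section \<open>Cauchy-Schwarz, completeness and projection\<close>

text \<open>Used twice: for the Cauchy-Schwarz inequality, and to show that a minimizing sequence is
  nearly orthogonal to \<open>V\<close>.\<close>

lemma discriminant_le_of_nonneg:
  fixes a b c :: real
  assumes "\<And>t. 0 \<le> a + 2 * t * b + t\<^sup>2 * c" "c \<ge> 0"
  shows "b\<^sup>2 \<le> a * c"
proof (cases "c = 0")
  case True
  have "b = 0"
  proof (rule ccontr)
    assume "b \<noteq> 0"
    \<comment> \<open>With \<open>c = 0\<close> the expression is affine in \<open>t\<close>; at
      this \<open>t\<close> it equals -1.\<close>
    then have "- (a + 1) / (2 * b) * b = - (a + 1) / 2"
      by (simp add: field_simps)
    then have "2 * (- (a + 1) / (2 * b)) * b = - a - 1"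
      unfolding mult.assoc by (simp only:) (simp add: field_simps)
    with assms(1)[of "- (a + 1) / (2 * b)"] show False
      unfolding True by linarith
  qed
  with True show ?thesis by simp
next
  case False
  with assms(2) have c: "c > 0" by simp
  \<comment> \<open>\<open>- b / c\<close> is the minimizer of the quadratic.\<close>
  have "0 \<le> (a + 2 * (- b / c) * b + (- b / c)\<^sup>2 * c) * c"
    using assms(1)[of "- b / c"] c by simp
  also have "\<dots> = a * c - b\<^sup>2"
    using c by (simp add: field_simps power2_eq_square)
  finally show ?thesis by simp
qed

lemma l2_Cauchy_Schwarz:
  assumes "l2_on S x" "l2_on S y"
  shows "(l2_inner S x y)\<^sup>2 \<le> l2_inner S x x * l2_inner S y y"
proof (rule discriminant_le_of_nonneg)
  show "0 \<le> l2_inner S x x + 2 * t * l2_inner S x y + t\<^sup>2 * l2_inner S y y" for t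
    using l2_inner_self_lincomb[OF assms, of 1 t] l2_inner_self_nonneg[of S "\<lambda>e. x e + t * y e"] by simp
qed (rule l2_inner_self_nonneg)

lemma l2_inner_tendsto:
  assumes x: "\<And>n. l2_on S (x n)" and l: "l2_on S l" and y: "l2_on S y"
    and lim: "(\<lambda>n. l2_inner S (\<lambda>e. x n e - l e) (\<lambda>e. x n e - l e)) \<longlonglongrightarrow> 0"
  shows "(\<lambda>n. l2_inner S y (x n)) \<longlonglongrightarrow> l2_inner S y l"
proof -
  have "(\<lambda>n. (l2_inner S y (\<lambda>e. x n e - l e))\<^sup>2) \<longlonglongrightarrow> 0"
  proof (rule tendsto_sandwich[OF _ _ tendsto_const])
    show "\<forall>\<^sub>F n in sequentially. (l2_inner S y (\<lambda>e. x n e - l e))\<^sup>2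
        \<le> l2_inner S y y * l2_inner S (\<lambda>e. x n e - l e) (\<lambda>e. x n e - l e)"
      using l2_Cauchy_Schwarz[OF y l2_on_diff[OF x l]] by simp
    show "(\<lambda>n. l2_inner S y y * l2_inner S (\<lambda>e. x n e - l e) (\<lambda>e. x n e - l e)) \<longlonglongrightarrow> 0"
      using tendsto_mult_right_zero[OF lim] .
  qed auto
  then have "(\<lambda>n. l2_inner S y (\<lambda>e. x n e - l e)) \<longlonglongrightarrow> 0"
    by (simp add: power_tendsto_0_iff)
  moreover have "l2_inner S y (\<lambda>e. x n e - l e) = l2_inner S y (x n) - l2_inner S y l" for n
    using l2_inner_lincomb_right[OF x l y, of 1 n "-1"] by simp
  ultimately show ?thesis by (simp add: LIM_zero_iff)
qed

text \<open>Coordinates are Cauchy, so a pointwise limit exists. The bound on finite partial sums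
  survives the limit in \<open>k\<close>, where \<open>d n + d k\<close> shrinks to
  \<open>d n\<close>; this gives both membership in the space and convergence in norm.\<close>

lemma l2_complete:
  assumes x: "\<And>n. l2_on S (x n)" and d: "d \<longlonglongrightarrow> (0::real)"
    and cauchy: "\<And>n k. l2_inner S (\<lambda>e. x n e - x k e) (\<lambda>e. x n e - x k e) \<le> d n + d k"
  shows "\<exists>l. l2_on S l \<and> (\<forall>e\<in>S. (\<lambda>n. x n e) \<longlonglongrightarrow> l e) \<and>
    (\<lambda>n. l2_inner S (\<lambda>e. x n e - l e) (\<lambda>e. x n e - l e)) \<longlonglongrightarrow> 0"
proof -
  have "Cauchy (\<lambda>n. x n e)" if "e \<in> S" for e
  proof (rule CauchyI)
    fix \<epsilon> :: real assume "\<epsilon> > 0"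
    then have "\<forall>\<^sub>F n in sequentially. d n < \<epsilon>\<^sup>2 / 2"
      by (intro order_tendstoD(2)[OF d]) auto
    then obtain M where M: "\<And>n. n \<ge> M \<Longrightarrow> d n < \<epsilon>\<^sup>2 / 2"
      by (auto simp: eventually_sequentially)
    have "\<bar>x m e - x n e\<bar> < \<epsilon>" if "m \<ge> M" "n \<ge> M" for m n
    proof (rule power2_less_imp_less)
      show "\<bar>x m e - x n e\<bar>\<^sup>2 < \<epsilon>\<^sup>2"
        using coordinate_le_l2_inner_self[OF l2_on_diff[OF x x] \<open>e \<in> S\<close>, of m n]
          cauchy[of m n] M[OF that(1)] M[OF that(2)] by simp
    qed (use \<open>\<epsilon> > 0\<close> in simp)
    then show "\<exists>M. \<forall>m\<ge>M. \<forall>n\<ge>M. norm (x m e - x n e) < \<epsilon>"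
      by auto
  qed
  then have "\<forall>e\<in>S. \<exists>l. (\<lambda>n. x n e) \<longlonglongrightarrow> l"
    using Cauchy_convergent convergent_def by blast
  then obtain l where l: "\<And>e. e \<in> S \<Longrightarrow> (\<lambda>n. x n e) \<longlonglongrightarrow> l e"
    by metis
  have fin: "(\<Sum>e\<in>F. (x n e - l e)\<^sup>2) \<le> d n" if F: "finite F" "F \<subseteq> S" for F n
  proof (rule LIMSEQ_le)
    show "(\<lambda>k. \<Sum>e\<in>F. (x n e - x k e)\<^sup>2) \<longlonglongrightarrow> (\<Sum>e\<in>F. (x n e - l e)\<^sup>2)"
      using F by (intro tendsto_intros l) auto
    show "(\<lambda>k. d n + d k) \<longlonglongrightarrow> d n"
      using tendsto_add[OF tendsto_const d, of "d n"] by simp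
    have "(\<Sum>e\<in>F. (x n e - x k e)\<^sup>2) \<le> d n + d k" for k
      using finite_sum_le_infsum[of "\<lambda>e. (x n e - x k e)\<^sup>2" S F]
        l2_on_diff[OF x x, of n k] F cauchy[of n k]
      by (simp add: l2_on_def l2_inner_def power2_eq_square)
    then show "\<exists>N. \<forall>k\<ge>N. (\<Sum>e\<in>F. (x n e - x k e)\<^sup>2) \<le> d n + d k" by blast
  qed
  have diff: "l2_on S (\<lambda>e. x n e - l e)" for n
    unfolding l2_on_def
    by (intro nonneg_bdd_above_summable_on bdd_aboveI[of _ "d n"]) (use fin in auto)
  have "l2_on S l"
    using l2_on_diff[OF x diff, of 0 0] by simp
  moreover have "(\<lambda>n. l2_inner S (\<lambda>e. x n e - l e) (\<lambda>e. x n e - l e)) \<longlonglongrightarrow> 0"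
  proof (rule tendsto_sandwich[OF _ _ tendsto_const d])
    show "\<forall>\<^sub>F n in sequentially. 0 \<le> l2_inner S (\<lambda>e. x n e - l e) (\<lambda>e. x n e - l e)"
      by (simp add: l2_inner_self_nonneg)
    have "l2_inner S (\<lambda>e. x n e - l e) (\<lambda>e. x n e - l e) \<le> d n" for n
      using infsum_le_finite_sums[of "\<lambda>e. (x n e - l e)\<^sup>2" S "d n"] diff[of n] fin
      by (simp add: l2_on_def l2_inner_def power2_eq_square)
    then show "\<forall>\<^sub>F n in sequentially. l2_inner S (\<lambda>e. x n e - l e) (\<lambda>e. x n e - l e) \<le> d n"
      by simp
  qed
  ultimately show ?thesis using l by blast
qed

text \<open>\<open>V\<close> is not assumed closed, so the component of \<open>x0\<close> orthogonal
  to \<open>V\<close> is only reached as a limit of \<open>x0 + v n\<close>. The sequence is chosen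
  to minimize the norm on the coset \<open>x0 + V\<close>.\<close>

lemma l2_projection:
  assumes x0: "l2_on S x0"
    and V: "\<And>v. v \<in> V \<Longrightarrow> l2_on S v" "V \<noteq> {}"
      "\<And>v w a b. v \<in> V \<Longrightarrow> w \<in> V \<Longrightarrow> (\<lambda>e. a * v e + b * w e) \<in> V"
  obtains x v where "l2_on S x" "\<And>n. v n \<in> V" "\<And>w. w \<in> V \<Longrightarrow> l2_inner S x w = 0"
    "\<And>e. e \<in> S \<Longrightarrow> (\<lambda>n. x0 e + v n e) \<longlonglongrightarrow> x e"
    "(\<lambda>n. l2_inner S (\<lambda>e. x0 e + v n e - x e) (\<lambda>e. x0 e + v n e - x e)) \<longlonglongrightarrow> 0"
proof -
  define E where "E = (\<lambda>v. l2_inner S (\<lambda>e. x0 e + v e) (\<lambda>e. x0 e + v e))"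
  define m where "m = Inf (E ` V)"
  have bdd: "bdd_below (E ` V)"
    by (rule bdd_belowI[of _ 0]) (auto simp: E_def l2_inner_self_nonneg)
  have m_le: "m \<le> E v" if "v \<in> V" for v
    unfolding m_def using that by (intro cInf_lower bdd) auto
  have "\<exists>v\<in>V. E v < m + inverse (real (Suc n))" for n
  proof -
    have "\<exists>z\<in>E ` V. z < m + inverse (real (Suc n))"
      using V(2) unfolding m_def by (intro cInf_lessD) auto
    then show ?thesis by blast
  qed
  then obtain v where v: "\<And>n. v n \<in> V" "\<And>n. E (v n) < m + inverse (real (Suc n))"
    by metis
  define x where "x = (\<lambda>n e. x0 e + v n e)"
  define \<delta> where "\<delta> = (\<lambda>n. E (v n) - m)"
  have x: "l2_on S (x n)" for n
    unfolding x_def by (intro l2_on_add x0 V v)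
  have \<delta>: "\<delta> \<longlonglongrightarrow> 0"
  proof (rule tendsto_sandwich[OF _ _ tendsto_const LIMSEQ_inverse_real_of_nat])
    show "\<forall>\<^sub>F n in sequentially. 0 \<le> \<delta> n"
      using m_le[OF v(1)] by (simp add: \<delta>_def)
    show "\<forall>\<^sub>F n in sequentially. \<delta> n \<le> inverse (real (Suc n))"
      using v(2) by (simp add: \<delta>_def less_imp_le algebra_simps)
  qed
  \<comment> \<open>Moving \<open>v n\<close> by \<open>t * w\<close> stays in \<open>V\<close>, so
    the squared norm cannot fall below \<open>m\<close>; the discriminant of this quadratic in
    \<open>t\<close> gives the bound.\<close>
  have near_orth: "(l2_inner S (x n) w)\<^sup>2 \<le> \<delta> n * l2_inner S w w" if w: "w \<in> V" for n w
  proof (rule discriminant_le_of_nonneg)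
    fix t
    have "m \<le> E (\<lambda>e. 1 * v n e + t * w e)"
      by (intro m_le V v w)
    also have "\<dots> = l2_inner S (\<lambda>e. 1 * x n e + t * w e) (\<lambda>e. 1 * x n e + t * w e)"
      by (simp add: E_def x_def algebra_simps)
    also have "\<dots> = E (v n) + 2 * t * l2_inner S (x n) w + t\<^sup>2 * l2_inner S w w"
      by (subst l2_inner_self_lincomb[OF x V(1)[OF w]]) (simp add: E_def x_def)
    finally show "0 \<le> \<delta> n + 2 * t * l2_inner S (x n) w + t\<^sup>2 * l2_inner S w w"
      by (simp add: \<delta>_def)
  qed (rule l2_inner_self_nonneg)
  \<comment> \<open>parallelogram law for \<open>x n\<close> and \<open>x k\<close>, whose midpoint lies in the same coset of \<open>V\<close>\<close>
  have cauchy: "l2_inner S (\<lambda>e. x n e - x k e) (\<lambda>e. x n e - x k e) \<le> 2 * \<delta> n + 2 * \<delta> k" for n k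
  proof -
    have "m \<le> E (\<lambda>e. 1/2 * v n e + 1/2 * v k e)"
      by (intro m_le V v)
    also have "\<dots> = l2_inner S (\<lambda>e. 1/2 * x n e + 1/2 * x k e) (\<lambda>e. 1/2 * x n e + 1/2 * x k e)"
      by (simp add: E_def x_def algebra_simps)
    also have "\<dots> = E (v n) / 4 + l2_inner S (x n) (x k) / 2 + E (v k) / 4"
      by (subst l2_inner_self_lincomb[OF x x]) (simp add: E_def x_def power2_eq_square)
    finally have "4 * m \<le> E (v n) + 2 * l2_inner S (x n) (x k) + E (v k)" by simp
    moreover have "l2_inner S (\<lambda>e. x n e - x k e) (\<lambda>e. x n e - x k e)
        = E (v n) - 2 * l2_inner S (x n) (x k) + E (v k)"
      using l2_inner_self_lincomb[OF x x, of 1 n "-1" k] by (simp add: E_def x_def)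
    ultimately show ?thesis by (simp add: \<delta>_def)
  qed
  have "(\<lambda>n. 2 * \<delta> n) \<longlonglongrightarrow> 0"
    using tendsto_mult_right_zero[OF \<delta>] .
  from l2_complete[OF x this cauchy]
  obtain l where l: "l2_on S l" "\<And>e. e \<in> S \<Longrightarrow> (\<lambda>n. x n e) \<longlonglongrightarrow> l e"
    "(\<lambda>n. l2_inner S (\<lambda>e. x n e - l e) (\<lambda>e. x n e - l e)) \<longlonglongrightarrow> 0"
    by blast
  have "l2_inner S l w = 0" if w: "w \<in> V" for w
  proof -
    have "(\<lambda>n. (l2_inner S w (x n))\<^sup>2) \<longlonglongrightarrow> 0"
    proof (rule tendsto_sandwich[OF _ _ tendsto_const])
      show "\<forall>\<^sub>F n in sequentially. (l2_inner S w (x n))\<^sup>2 \<le> \<delta> n * l2_inner S w w"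
        using near_orth[OF w] by (simp add: l2_inner_commute)
      show "(\<lambda>n. \<delta> n * l2_inner S w w) \<longlonglongrightarrow> 0"
        using tendsto_mult_left_zero[OF \<delta>] .
    qed auto
    then have "(\<lambda>n. l2_inner S w (x n)) \<longlonglongrightarrow> 0"
      by (simp add: power_tendsto_0_iff)
    moreover have "(\<lambda>n. l2_inner S w (x n)) \<longlonglongrightarrow> l2_inner S w l"
      by (rule l2_inner_tendsto[OF x l(1) V(1)[OF w] l(3)])
    ultimately show ?thesis
      using LIMSEQ_unique l2_inner_commute by metis
  qed
  with l v(1) show thesis
    by (intro that[of l v]) (auto simp: x_def)
qed


subsection \<open>Gradients and flows\<close>

definition proper_edges :: "('v, 'e) network \<Rightarrow> 'e set" where
  "proper_edges N = {e \<in> edges N. proper_uprod (ends N e)}"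

text \<open>
  Gradients and flows are scaled by powers of the resistance so that energies become squared
  norms in the unweighted \<open>\<ell>\<^sup>2\<close> space over \<open>proper_edges N\<close>.
\<close>

definition norm_grad :: "('v, 'e) network \<Rightarrow> ('v \<Rightarrow> real) \<Rightarrow> 'e \<Rightarrow> real" where
  "norm_grad N h e =
     (h (ter (orientation N e)) - h (init (orientation N e))) / sqrt (res N e)"

definition norm_flow :: "('v, 'e) network \<Rightarrow> (('v, 'e) dedge \<Rightarrow> real) \<Rightarrow> 'e \<Rightarrow> real" where
  "norm_flow N \<phi> e = sqrt (res N e) * \<phi> (orientation N e)"

text \<open>The sign is such that the flow runs towards higher potential; the accumulation at
  \<open>v\<close> is then the sum occurring in \<open>harmonic\<close>.\<close>

definition grad_flow :: "('v, 'e) network \<Rightarrow> ('v \<Rightarrow> real) \<Rightarrow> ('v, 'e) dedge \<Rightarrow> real" where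
  "grad_flow N h d = conductance N (fst d) * (h (ter d) - h (init d))"

text \<open>Inverse to \<open>norm_flow\<close>: it turns a function on proper edges back into an
  antisymmetric function, with the minus sign on the orientation that was not chosen.\<close>

definition edge_flow :: "('v, 'e) network \<Rightarrow> ('e \<Rightarrow> real) \<Rightarrow> ('v, 'e) dedge \<Rightarrow> real" where
  "edge_flow N x d =
     (if d = orientation N (fst d) then 1 else - 1) * x (fst d) / sqrt (res N (fst d))"

section \<open>Directed edges and energies as squared norms\<close>

lemma dedge_simps [simp]:
  "init (e, x, y) = x" "ter (e, x, y) = y" "rev_dedge (e, x, y) = (e, y, x)"
  by (simp_all add: init_def ter_def rev_dedge_def)

lemma rev_dedge_proj [simp]:
  "init (rev_dedge d) = ter d" "ter (rev_dedge d) = init d" "fst (rev_dedge d) = fst d"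
  "rev_dedge (rev_dedge d) = d"
  by (cases d; simp)+

lemma in_dedges_iff:
  "d \<in> dedges N \<longleftrightarrow> fst d \<in> edges N \<and> ends N (fst d) = Upair (init d) (ter d) \<and> init d \<noteq> ter d"
  by (cases d) (auto simp: dedges_def)

lemma rev_dedge_in_dedges_iff [simp]: "rev_dedge d \<in> dedges N \<longleftrightarrow> d \<in> dedges N"
  by (cases d) (auto simp: in_dedges_iff)

lemma dedge_eqI: "fst d = fst d' \<Longrightarrow> init d = init d' \<Longrightarrow> ter d = ter d' \<Longrightarrow> d = d'"
  by (cases d; cases d') simp

lemma antisymmetric_rev_dedge:
  assumes "antisymmetric N \<phi>" "d \<in> dedges N"
  shows "\<phi> (rev_dedge d) = - \<phi> d"
proof -
  have "\<phi> d = - \<phi> (rev_dedge d)"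
    using assms unfolding antisymmetric_def by blast
  then show ?thesis by linarith
qed

text \<open>A proper edge is not a loop, so it has a directed version and the choice in
  \<open>orientation\<close> has a witness.\<close>

lemma orientation:
  assumes "e \<in> proper_edges N"
  shows "orientation N e \<in> dedges N" "fst (orientation N e) = e"
proof -
  obtain x y where "ends N e = Upair x y" by (cases "ends N e")
  with assms have "(e, x, y) \<in> dedges N \<and> fst (e, x, y) = e"
    by (auto simp: proper_edges_def dedges_def)
  then have "orientation N e \<in> dedges N \<and> fst (orientation N e) = e"
    unfolding orientation_def by (rule someI)
  then show "orientation N e \<in> dedges N" "fst (orientation N e) = e" by auto
qed

lemma proper_edge_ends:
  assumes "e \<in> proper_edges N"
  shows "ends N e = Upair (init (orientation N e)) (ter (orientation N e))"
    and "init (orientation N e) \<noteq> ter (orientation N e)"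
  using orientation[OF assms] by (auto simp: in_dedges_iff)

lemma proper_edge_verts:
  assumes "is_network N" "e \<in> proper_edges N"
  shows "init (orientation N e) \<in> verts N" "ter (orientation N e) \<in> verts N"
  using assms proper_edge_ends(1)[OF assms(2)] by (auto simp: is_network_def proper_edges_def)

lemma proper_edge_res_pos: "is_network N \<Longrightarrow> e \<in> proper_edges N \<Longrightarrow> res N e > 0"
  by (auto simp: is_network_def proper_edges_def)

lemma proper_edges_subset: "proper_edges N \<subseteq> edges N"
  by (auto simp: proper_edges_def)

lemma dedge_orientation_cases:
  assumes "d \<in> dedges N"
  shows "fst d \<in> proper_edges N"
    and "d = orientation N (fst d) \<or> d = rev_dedge (orientation N (fst d))"
proof -
  show e: "fst d \<in> proper_edges N"
    using assms by (auto simp: in_dedges_iff proper_edges_def)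
  show "d = orientation N (fst d) \<or> d = rev_dedge (orientation N (fst d))"
    using assms orientation(2)[OF e] proper_edge_ends(1)[OF e]
    by (auto simp: in_dedges_iff intro: dedge_eqI)
qed

text \<open>Loops have zero drop, so the sum over all edges may be restricted to proper
  ones.\<close>

lemma finite_potential_energy_iff_l2_on:
  assumes "is_network N"
  shows "finite_potential_energy N h \<longleftrightarrow> l2_on (proper_edges N) (norm_grad N h)"
proof -
  have eq: "sq_drop h (ends N e) / res N e = (norm_grad N h e)\<^sup>2" if "e \<in> proper_edges N" for e
    using proper_edge_ends(1)[OF that] proper_edge_res_pos[OF assms that]
    by (simp add: norm_grad_def power_divide power2_commute)
  have zero: "sq_drop h (ends N e) / res N e = 0" if "e \<in> edges N - proper_edges N" for e
    using that by (cases "ends N e") (auto simp: proper_edges_def)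
  show ?thesis
    unfolding finite_potential_energy_def l2_on_def
    by (rule summable_on_cong_neutral) (use eq zero proper_edges_subset[of N] in auto)
qed

lemma finite_flow_energy_iff_l2_on:
  assumes "is_network N"
  shows "finite_flow_energy N \<phi> \<longleftrightarrow> l2_on (proper_edges N) (norm_flow N \<phi>)"
  unfolding finite_flow_energy_def l2_on_def proper_edges_def[symmetric]
  by (intro summable_on_cong)
    (use proper_edge_res_pos[OF assms] in \<open>auto simp: norm_flow_def power_mult_distrib less_imp_le\<close>)

lemma antisymmetric_grad_flow: "antisymmetric N (grad_flow N h)"
  by (simp add: antisymmetric_def grad_flow_def algebra_simps)

lemma norm_flow_grad_flow:
  assumes "is_network N" "e \<in> proper_edges N"
  shows "norm_flow N (grad_flow N h) e = norm_grad N h e"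
proof -
  have "sqrt (res N e) * conductance N e = 1 / sqrt (res N e)"
    using proper_edge_res_pos[OF assms] by (simp add: conductance_def field_simps)
  then show ?thesis
    by (simp add: norm_flow_def grad_flow_def norm_grad_def orientation(2)[OF assms(2)]
        mult.assoc[symmetric])
qed

text \<open>Reversal maps the edges leaving \<open>v\<close> bijectively to those entering
  it.\<close>

lemma harmonic_iff_accumulation:
  "harmonic N h \<longleftrightarrow> (\<forall>v\<in>verts N. accumulation N (grad_flow N h) v = 0)"
proof -
  have "(\<Sum>d | d \<in> dedges N \<and> init d = v. conductance N (fst d) * (h v - h (ter d)))
      = (\<Sum>d | d \<in> dedges N \<and> ter d = v. grad_flow N h d)" for v
    by (rule sum.reindex_bij_witness[of _ rev_dedge rev_dedge]) (auto simp: grad_flow_def)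
  then show ?thesis by (simp add: harmonic_def accumulation_def)
qed

lemma antisymmetric_edge_flow: "antisymmetric N (edge_flow N x)"
  unfolding antisymmetric_def
proof
  fix d assume d: "d \<in> dedges N"
  have "d \<noteq> rev_dedge d"
    using d by (cases d) (auto simp: in_dedges_iff)
  moreover have "d = orientation N (fst d) \<or> rev_dedge d = orientation N (fst d)"
    using dedge_orientation_cases(2)[OF d] rev_dedge_proj(4) by metis
  ultimately show "edge_flow N x d = - edge_flow N x (rev_dedge d)"
    by (auto simp: edge_flow_def)
qed

lemma norm_flow_edge_flow:
  assumes "is_network N" "e \<in> proper_edges N"
  shows "norm_flow N (edge_flow N x) e = x e"
  using proper_edge_res_pos[OF assms] orientation(2)[OF assms(2)]
  by (simp add: norm_flow_def edge_flow_def)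

text \<open>Each edge at \<open>u\<close> has exactly one direction entering \<open>u\<close>, and
  antisymmetry supplies the sign relative to the chosen orientation. Any finite superset
  \<open>T\<close> of the edges at \<open>u\<close> is allowed, so that one \<open>T\<close> can
  serve several vertices at once.\<close>

lemma accumulation_eq_sum_edges:
  assumes "antisymmetric N \<phi>" "finite T" "T \<subseteq> proper_edges N"
    "{e \<in> proper_edges N. u \<in> set_uprod (ends N e)} \<subseteq> T"
  shows "accumulation N \<phi> u =
    (\<Sum>e\<in>T. \<phi> (orientation N e) *
      (of_bool (ter (orientation N e) = u) - of_bool (init (orientation N e) = u)))"
    (is "_ = sum ?g T")
proof -
  let ?I = "{e \<in> proper_edges N. u \<in> set_uprod (ends N e)}"
  let ?d = "\<lambda>e. if ter (orientation N e) = u then orientation N e else rev_dedge (orientation N e)"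
  have "accumulation N \<phi> u = sum ?g ?I"
    unfolding accumulation_def
  proof (rule sum.reindex_bij_witness[of _ ?d fst])
    fix d assume d: "d \<in> {d \<in> dedges N. ter d = u}"
    define e where "e = fst d"
    have e: "e \<in> proper_edges N" and cases: "d = orientation N e \<or> d = rev_dedge (orientation N e)"
      using dedge_orientation_cases[of d N] d unfolding e_def by blast+
    note ends = proper_edge_ends[OF e]
    have anti: "\<phi> (rev_dedge (orientation N e)) = - \<phi> (orientation N e)"
      by (rule antisymmetric_rev_dedge[OF assms(1) orientation(1)[OF e]])
    have "?d e = d \<and> e \<in> ?I \<and> ?g e = \<phi> d"
      using cases
    proof
      assume "d = orientation N e"
      moreover from this have "ter (orientation N e) = u" "init (orientation N e) \<noteq> u"
        using d ends(2) by simp_all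
      ultimately show ?thesis using e ends(1) by simp
    next
      assume "d = rev_dedge (orientation N e)"
      moreover from this have "init (orientation N e) = u" "ter (orientation N e) \<noteq> u"
        using d ends(2) by simp_all
      ultimately show ?thesis using e ends(1) anti by simp
    qed
    then show "?d (fst d) = d" "fst d \<in> ?I" "?g (fst d) = \<phi> d"
      unfolding e_def by blast+
  next
    fix e assume "e \<in> ?I"
    then have e: "e \<in> proper_edges N" "u \<in> set_uprod (ends N e)" by simp_all
    show "fst (?d e) = e"
      by (simp add: orientation(2)[OF e(1)])
    have "init (orientation N e) = u \<or> ter (orientation N e) = u"
      using e(2) unfolding proper_edge_ends(1)[OF e(1)] by auto
    then show "?d e \<in> {d \<in> dedges N. ter d = u}"
      by (auto simp: orientation(1)[OF e(1)])
  qed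
  also have "\<dots> = sum ?g T"
  proof (rule sum.mono_neutral_left[OF assms(2,4)], rule ballI)
    fix e assume "e \<in> T - ?I"
    then have e: "e \<in> proper_edges N" "u \<notin> set_uprod (ends N e)"
      using assms(3) by blast+
    then show "?g e = 0"
      unfolding proper_edge_ends(1)[OF e(1)] by auto
  qed
  finally show ?thesis .
qed

section \<open>Summation by parts against finitely supported functions\<close>

lemma incident_proper_edges_finite:
  assumes "locally_finite N" "finite F" "F \<subseteq> verts N"
  shows "finite {e \<in> proper_edges N. \<exists>u\<in>F. u \<in> set_uprod (ends N e)}"
proof -
  have "finite (\<Union>u\<in>F. {e \<in> edges N. u \<in> set_uprod (ends N e)})"
    using assms by (auto simp: locally_finite_def)
  then show ?thesis
    by (rule finite_subset[rotated]) (auto simp: proper_edges_def)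
qed

definition finitely_supported :: "('v, 'e) network \<Rightarrow> ('v \<Rightarrow> real) \<Rightarrow> bool" where
  "finitely_supported N f \<longleftrightarrow> finite {u \<in> verts N. f u \<noteq> 0}"

lemma finitely_supported_grad:
  assumes "is_network N" "locally_finite N" "finitely_supported N f"
  shows "finite {e \<in> proper_edges N. norm_grad N f e \<noteq> 0}"
proof (rule finite_subset)
  let ?F = "{u \<in> verts N. f u \<noteq> 0}"
  show "finite {e \<in> proper_edges N. \<exists>u\<in>?F. u \<in> set_uprod (ends N e)}"
    using assms by (intro incident_proper_edges_finite) (auto simp: finitely_supported_def)
  show "{e \<in> proper_edges N. norm_grad N f e \<noteq> 0}
      \<subseteq> {e \<in> proper_edges N. \<exists>u\<in>?F. u \<in> set_uprod (ends N e)}"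
  proof
    fix e assume e: "e \<in> {e \<in> proper_edges N. norm_grad N f e \<noteq> 0}"
    then have "f (init (orientation N e)) \<noteq> 0 \<or> f (ter (orientation N e)) \<noteq> 0"
      by (auto simp: norm_grad_def)
    with e show "e \<in> {e \<in> proper_edges N. \<exists>u\<in>?F. u \<in> set_uprod (ends N e)}"
      using proper_edge_verts[OF assms(1), of e] by (auto simp: proper_edge_ends(1))
  qed
qed

text \<open>Summation by parts. The factors \<open>sqrt (res N e)\<close> cancel, only the finitely
  many edges meeting \<open>F\<close> contribute, and writing \<open>f\<close> as a combination of
  point indicators allows the two finite sums to be swapped.\<close>

lemma l2_inner_flow_grad:
  assumes N: "is_network N" "locally_finite N" and \<phi>: "antisymmetric N \<phi>"
    and F: "finite F" "F \<subseteq> verts N" "\<And>u. u \<in> verts N - F \<Longrightarrow> f u = 0"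
  shows "l2_inner (proper_edges N) (norm_flow N \<phi>) (norm_grad N f)
    = (\<Sum>u\<in>F. f u * accumulation N \<phi> u)"
proof -
  define T where "T = {e \<in> proper_edges N. \<exists>u\<in>F. u \<in> set_uprod (ends N e)}"
  let ?h = "\<lambda>e. ter (orientation N e)" and ?t = "\<lambda>e. init (orientation N e)"
  have T: "finite T" "T \<subseteq> proper_edges N"
    using incident_proper_edges_finite[OF N(2) F(1,2)] by (auto simp: T_def)
  have val: "f v = (\<Sum>u\<in>F. f u * of_bool (v = u))" if "v \<in> verts N" for v
  proof -
    have "(\<Sum>u\<in>F. f u * of_bool (v = u)) = (\<Sum>u\<in>F. if v = u then f u else 0)"
      by (intro sum.cong) auto
    with F that show ?thesis by auto
  qed
  have summand: "norm_flow N \<phi> e * norm_grad N f e = \<phi> (orientation N e) * (f (?h e) - f (?t e))"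
    if "e \<in> proper_edges N" for e
    using proper_edge_res_pos[OF N(1) that] by (simp add: norm_flow_def norm_grad_def)
  have "l2_inner (proper_edges N) (norm_flow N \<phi>) (norm_grad N f)
      = infsum (\<lambda>e. \<phi> (orientation N e) * (f (?h e) - f (?t e))) T"
    unfolding l2_inner_def
  proof (rule infsum_cong_neutral)
    fix e assume e: "e \<in> proper_edges N - T"
    then have "f (?h e) = 0" "f (?t e) = 0"
      using F(3) proper_edge_verts[OF N(1), of e] by (auto simp: T_def proper_edge_ends(1))
    then show "norm_flow N \<phi> e * norm_grad N f e = 0" by (simp add: norm_grad_def)
  qed (use T summand in auto)
  also have "\<dots> = (\<Sum>e\<in>T. \<phi> (orientation N e) * (f (?h e) - f (?t e)))"
    using T by simp
  also have "\<dots> = (\<Sum>e\<in>T. \<Sum>u\<in>F. f u * (\<phi> (orientation N e) * (of_bool (?h e = u) - of_bool (?t e = u))))"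
  proof (rule sum.cong[OF refl])
    fix e assume "e \<in> T"
    then have v: "?h e \<in> verts N" "?t e \<in> verts N"
      using T proper_edge_verts[OF N(1)] by auto
    show "\<phi> (orientation N e) * (f (?h e) - f (?t e))
        = (\<Sum>u\<in>F. f u * (\<phi> (orientation N e) * (of_bool (?h e = u) - of_bool (?t e = u))))"
      by (subst val[OF v(1)], subst val[OF v(2)])
        (simp only: sum_subtractf[symmetric] sum_distrib_left algebra_simps)
  qed
  also have "\<dots> = (\<Sum>u\<in>F. f u * (\<Sum>e\<in>T. \<phi> (orientation N e) * (of_bool (?h e = u) - of_bool (?t e = u))))"
    by (subst sum.swap) (simp add: sum_distrib_left)
  also have "\<dots> = (\<Sum>u\<in>F. f u * accumulation N \<phi> u)"
    by (intro sum.cong refl arg_cong2[of _ _ _ _ "(*)"] accumulation_eq_sum_edges[symmetric] \<phi> T)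
      (auto simp: T_def)
  finally show ?thesis .
qed

lemma norm_grad_lincomb:
  "norm_grad N (\<lambda>v. a * f v + b * g v) = (\<lambda>e. a * norm_grad N f e + b * norm_grad N g e)"
  by (rule ext) (simp add: norm_grad_def add_divide_distrib diff_divide_distrib algebra_simps)

lemma finitely_supported_lincomb:
  assumes "finitely_supported N f" "finitely_supported N g"
  shows "finitely_supported N (\<lambda>v. a * f v + b * g v)"
proof -
  have "finite ({u \<in> verts N. f u \<noteq> 0} \<union> {u \<in> verts N. g u \<noteq> 0})"
    using assms by (simp add: finitely_supported_def)
  then show ?thesis
    unfolding finitely_supported_def by (rule finite_subset[rotated]) auto
qed

lemma l2_on_finitely_supported_grad:
  assumes "is_network N" "locally_finite N" "finitely_supported N f"
  shows "l2_on (proper_edges N) (norm_grad N f)"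
  by (intro l2_on_finite_support finitely_supported_grad assms)

text \<open>This translates orthogonality to gradients of point indicators into (K1).\<close>

lemma accumulation_eq_l2_inner:
  assumes "is_network N" "locally_finite N" "antisymmetric N \<phi>" "v \<in> verts N"
  shows "accumulation N \<phi> v
    = l2_inner (proper_edges N) (norm_flow N \<phi>) (norm_grad N (\<lambda>u. of_bool (u = v)))"
  using l2_inner_flow_grad[OF assms(1-3), of "{v}" "\<lambda>u. of_bool (u = v)"] assms(4) by auto

lemma finitely_supported_indicator: "finitely_supported N (\<lambda>u. of_bool (u = v))"
  unfolding finitely_supported_def by (rule finite_subset[of _ "{v}"]) auto

text \<open>
  Project the gradient of the indicator of \<open>v\<close> along the gradients of the finitely supported
  functions vanishing at \<open>v\<close>: if the projection were non-zero, it would be a \<open>v\<close>-flow.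
\<close>

lemma small_energy_of_not_transient:
  assumes A: "is_network A" "locally_finite A" "\<not> transient A" "v \<in> verts A" and "\<epsilon> > 0"
  obtains f where "finitely_supported A f" "f v = 1"
    "l2_inner (proper_edges A) (norm_grad A f) (norm_grad A f) < \<epsilon>"
proof -
  let ?S = "proper_edges A" and ?I = "\<lambda>w u. of_bool (u = w) :: real"
  \<comment> \<open>Adding elements of \<open>K\<close> to the indicator of \<open>v\<close> keeps
    the value 1 at \<open>v\<close>, and the indicator of every other vertex lies in
    \<open>K\<close>.\<close>
  define K where "K = {f. finitely_supported A f \<and> f v = 0}"
  have K_l2: "l2_on ?S (norm_grad A f)" if "finitely_supported A f" for f
    by (rule l2_on_finitely_supported_grad[OF A(1,2) that])
  have x0: "l2_on ?S (norm_grad A (?I v))"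
    by (intro K_l2 finitely_supported_indicator)
  obtain x k where x: "l2_on ?S x" and k: "\<And>n. k n \<in> norm_grad A ` K"
    and orth: "\<And>w. w \<in> norm_grad A ` K \<Longrightarrow> l2_inner ?S x w = 0"
    and lim: "(\<lambda>n. l2_inner ?S (\<lambda>e. norm_grad A (?I v) e + k n e - x e)
        (\<lambda>e. norm_grad A (?I v) e + k n e - x e)) \<longlonglongrightarrow> 0"
  proof (rule l2_projection[OF x0, of "norm_grad A ` K"])
    show "norm_grad A ` K \<noteq> {}"
      by (auto simp: K_def finitely_supported_def intro: exI[of _ "\<lambda>_. 0"])
    show "l2_on ?S w" if "w \<in> norm_grad A ` K" for w
      using that K_l2 by (auto simp: K_def)
    show "(\<lambda>e. a * w e + b * w' e) \<in> norm_grad A ` K"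
      if ww: "w \<in> norm_grad A ` K" "w' \<in> norm_grad A ` K" for w w' a b
    proof -
      obtain f g where fg: "f \<in> K" "g \<in> K" "w = norm_grad A f" "w' = norm_grad A g"
        using ww by auto
      have "(\<lambda>u. a * f u + b * g u) \<in> K"
        using fg by (simp add: K_def finitely_supported_lincomb)
      with fg show ?thesis
        by (intro image_eqI[of _ _ "\<lambda>u. a * f u + b * g u"]) (simp_all add: norm_grad_lincomb)
    qed
  qed blast
  from k obtain f where f: "\<And>n. f n \<in> K" "\<And>n. k n = norm_grad A (f n)"
    unfolding image_iff Bex_def by metis
  define g where "g = (\<lambda>n u. ?I v u + f n u)"
  have g_grad: "norm_grad A (g n) = (\<lambda>e. norm_grad A (?I v) e + k n e)" for n
    using norm_grad_lincomb[of A 1 "?I v" 1 "f n"] f(2) by (simp add: g_def)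
  have g: "finitely_supported A (g n)" "g n v = 1" for n
    using finitely_supported_lincomb[OF finitely_supported_indicator[of A v], of "f n" 1 1] f(1)[of n]
    by (auto simp: g_def K_def)
  define \<phi> where "\<phi> = edge_flow A x"
  have \<phi>: "antisymmetric A \<phi>" "\<And>e. e \<in> ?S \<Longrightarrow> norm_flow A \<phi> e = x e"
    unfolding \<phi>_def using antisymmetric_edge_flow norm_flow_edge_flow[OF A(1)] by auto
  have acc: "accumulation A \<phi> w = l2_inner ?S x (norm_grad A (?I w))" if "w \<in> verts A" for w
    unfolding accumulation_eq_l2_inner[OF A(1,2) \<phi>(1) that] by (rule l2_inner_cong) (simp_all add: \<phi>)
  have "K1 A \<phi> w" if w: "w \<in> verts A - {v}" for w
  proof -
    have "?I w \<in> K"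
      using w by (auto simp: K_def finitely_supported_indicator)
    with w show ?thesis
      by (simp add: K1_def acc orth)
  qed
  moreover have "finite_flow_energy A \<phi>"
    unfolding finite_flow_energy_iff_l2_on[OF A(1)]
    using x l2_on_cong[of ?S "norm_flow A \<phi>" x] \<phi>(2) by simp
  \<comment> \<open>A non-zero accumulation at \<open>v\<close> would make \<open>\<phi>\<close> a
    flow witnessing transience.\<close>
  ultimately have acc0: "l2_inner ?S x (norm_grad A (?I v)) = 0"
    using A(3,4) \<phi>(1) acc[OF A(4)] unfolding transient_def is_flow_def by blast
  have xg: "l2_inner ?S x (norm_grad A (g n)) = 0" for n
  proof -
    have "l2_inner ?S x (norm_grad A (g n))
        = 1 * l2_inner ?S x (norm_grad A (?I v)) + 1 * l2_inner ?S x (k n)"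
      unfolding g_grad
      using l2_inner_lincomb_right[OF x0 _ x, of "k n" 1 1] K_l2[of "f n"] f
      by (simp add: K_def)
    with acc0 orth[OF k] show ?thesis by simp
  qed
  have gl2: "l2_on ?S (norm_grad A (g n))" for n by (rule K_l2[OF g(1)])
  \<comment> \<open>By \<open>xg\<close> the mixed term vanishes, so the squared distance from
    \<open>norm_grad A (g n)\<close> to \<open>x\<close> is the sum of the two squared norms. As it
    tends to zero, so does the energy of \<open>g n\<close>.\<close>
  have "(\<lambda>n. l2_inner ?S (norm_grad A (g n)) (norm_grad A (g n)) + l2_inner ?S x x) \<longlonglongrightarrow> 0"
  proof -
    have "l2_inner ?S (\<lambda>e. norm_grad A (g n) e - x e) (\<lambda>e. norm_grad A (g n) e - x e)
      = l2_inner ?S (norm_grad A (g n)) (norm_grad A (g n)) + l2_inner ?S x x" for n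
      using l2_inner_self_lincomb[OF gl2 x, of 1 n "-1"] xg
      by (simp add: l2_inner_commute[of ?S "norm_grad A (g n)" x])
    with lim show ?thesis by (simp add: g_grad)
  qed
  then have "\<forall>\<^sub>F n in sequentially.
      l2_inner ?S (norm_grad A (g n)) (norm_grad A (g n)) + l2_inner ?S x x < \<epsilon>"
    using \<open>\<epsilon> > 0\<close> by (rule order_tendstoD)
  then obtain n where "l2_inner ?S (norm_grad A (g n)) (norm_grad A (g n)) + l2_inner ?S x x < \<epsilon>"
    by (auto simp: eventually_sequentially)
  with l2_inner_self_nonneg[of ?S x] g show thesis
    by (intro that[of "g n"]) auto
qed


subsection \<open>Subnetworks and level sets\<close>

lemma sq_drop_map_uprod: "sq_drop h (map_uprod f p) = sq_drop (h \<circ> f) p"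
  by (cases p) simp

text \<open>Contraction keeps edges and resistances, so a potential on it can be pulled back to
  \<open>N\<close> with the same edge terms.\<close>

lemma finite_potential_energy_contraction:
  "finite_potential_energy (contraction N A B) \<rho> \<longleftrightarrow>
   finite_potential_energy N (\<rho> \<circ> contract_vertex A B)"
  by (simp add: finite_potential_energy_def contraction_def sq_drop_map_uprod)

text \<open>Both choices are made from the same set of candidates, so gradients in \<open>A\<close>
  and in \<open>N\<close> agree including the sign.\<close>

lemma subnetwork_orientation:
  assumes "subnetwork A N" "e \<in> edges A"
  shows "orientation A e = orientation N e"
proof -
  have "(d \<in> dedges A \<and> fst d = e) = (d \<in> dedges N \<and> fst d = e)" for d
    using assms by (auto simp: in_dedges_iff subnetwork_def)
  then show ?thesis by (simp add: orientation_def)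
qed

lemma subnetwork_proper_edges: "subnetwork A N \<Longrightarrow> proper_edges A \<subseteq> proper_edges N"
  by (auto simp: subnetwork_def proper_edges_def)

lemma subnetwork_norm_grad:
  assumes "subnetwork A N" "e \<in> proper_edges A"
  shows "norm_grad A h e = norm_grad N h e"
proof -
  have e: "e \<in> edges A" using assms(2) by (simp add: proper_edges_def)
  then have "res A e = res N e" using assms(1) by (simp add: subnetwork_def)
  with subnetwork_orientation[OF assms(1) e] show ?thesis
    by (simp add: norm_grad_def)
qed

lemma subnetwork_locally_finite:
  assumes "subnetwork A N" "locally_finite N"
  shows "locally_finite A"
  unfolding locally_finite_def
proof
  fix v assume "v \<in> verts A"
  with assms have "finite {e \<in> edges N. v \<in> set_uprod (ends N e)}"
    by (auto simp: locally_finite_def subnetwork_def)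
  then show "finite {e \<in> edges A. v \<in> set_uprod (ends A e)}"
    by (rule finite_subset[rotated]) (use assms(1) in \<open>auto simp: subnetwork_def\<close>)
qed

definition induced :: "('v, 'e) network \<Rightarrow> 'v set \<Rightarrow> ('v, 'e) network" where
  "induced N X =
     \<lparr>verts = X, edges = {e \<in> edges N. set_uprod (ends N e) \<subseteq> X}, ends = ends N, res = res N\<rparr>"

lemma verts_induced [simp]: "verts (induced N X) = X"
  by (simp add: induced_def)

lemma subnetwork_induced:
  "is_network N \<Longrightarrow> X \<subseteq> verts N \<Longrightarrow> subnetwork (induced N X) N"
  by (auto simp: induced_def subnetwork_def is_network_def)

lemma proper_edges_induced:
  "proper_edges (induced N X) = {e \<in> proper_edges N. set_uprod (ends N e) \<subseteq> X}"
  by (auto simp: induced_def proper_edges_def)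

text \<open>On a path from \<open>a\<close> to \<open>b\<close> the truth value of \<open>P\<close>
  changes along some edge. Its chosen orientation may point either way, hence the symmetric
  conclusion.\<close>

lemma connected_crossing_edge:
  assumes "connected_network N" "a \<in> verts N" "b \<in> verts N" "P a" "\<not> P b"
  obtains e where "e \<in> proper_edges N"
    "P (init (orientation N e)) \<noteq> P (ter (orientation N e))"
proof -
  have "(a, b) \<in> (adjacency N)\<^sup>*"
    using assms by (simp add: connected_network_def)
  then have "\<exists>(x, y)\<in>adjacency N. P x \<and> \<not> P y"
    using assms(4,5) by (induction rule: rtrancl_induct) auto
  then obtain x y e where xy: "P x" "\<not> P y" and e: "e \<in> edges N" "ends N e = Upair x y"
    by (auto simp: adjacency_def)
  from xy e have pe: "e \<in> proper_edges N"
    by (auto simp: proper_edges_def)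
  moreover have "P (init (orientation N e)) \<noteq> P (ter (orientation N e))"
    using proper_edge_ends(1)[OF pe] e(2) xy by auto
  ultimately show thesis by (rule that)
qed

text \<open>Summation by parts: the gradient flow of a harmonic function has zero accumulation
  everywhere.\<close>

lemma harmonic_orthogonal_finitely_supported:
  assumes N: "is_network N" "locally_finite N" and u: "harmonic N u" and f: "finitely_supported N f"
  shows "l2_inner (proper_edges N) (norm_grad N u) (norm_grad N f) = 0"
proof -
  let ?F = "{v \<in> verts N. f v \<noteq> 0}"
  have "l2_inner (proper_edges N) (norm_grad N u) (norm_grad N f)
      = l2_inner (proper_edges N) (norm_flow N (grad_flow N u)) (norm_grad N f)"
    by (rule l2_inner_cong) (simp_all add: norm_flow_grad_flow[OF N(1)])
  also have "\<dots> = (\<Sum>v\<in>?F. f v * accumulation N (grad_flow N u) v)"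
    by (rule l2_inner_flow_grad[OF N antisymmetric_grad_flow])
      (use f in \<open>auto simp: finitely_supported_def\<close>)
  also have "\<dots> = 0"
    using u by (intro sum.neutral) (auto simp: harmonic_iff_accumulation)
  finally show ?thesis .
qed

text \<open>
  If the superlevel set were not transient, there would be functions \<open>f\<close> of small energy, finitely
  supported in it and equal to \<open>1\<close> at the upper end of an edge leaving it. Pairing with the
  harmonic function \<open>u\<close> gives \<open>0\<close>, but the contribution of the leaving edges has a sign and stays
  away from \<open>0\<close>, while the remaining edges contribute little by the Cauchy--Schwarz inequality.
\<close>

lemma transient_superlevel:
  assumes N: "is_network N" "connected_network N" "locally_finite N"
    and u: "harmonic N u" "finite_potential_energy N u"
    and ab: "a \<in> verts N" "b \<in> verts N" "q \<le> u a" "u b < q"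
  shows "transient (induced N {w \<in> verts N. q \<le> u w})"
proof (rule ccontr)
  let ?X = "{w \<in> verts N. q \<le> u w}"
  let ?t = "\<lambda>e. init (orientation N e)" and ?h = "\<lambda>e. ter (orientation N e)"
  define A where "A = induced N ?X"
  assume "\<not> transient (induced N ?X)"
  then have nt: "\<not> transient A" by (simp add: A_def)
  have A: "subnetwork A N" "is_network A" "locally_finite A" "verts A = ?X"
    using subnetwork_induced[OF N(1), of ?X] subnetwork_locally_finite[OF _ N(3), of A]
    by (auto simp: A_def subnetwork_def)
  have peA: "e \<in> proper_edges A \<longleftrightarrow> q \<le> u (?t e) \<and> q \<le> u (?h e)" if "e \<in> proper_edges N" for e
    using proper_edge_verts[OF N(1) that] that
    by (auto simp: A_def proper_edges_induced proper_edge_ends(1))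
  let ?E = "l2_inner (proper_edges A) (norm_grad N u) (norm_grad N u)"
  have ul2: "l2_on (proper_edges N) (norm_grad N u)"
    using u(2) finite_potential_energy_iff_l2_on[OF N(1)] by blast
  obtain e0 where e0: "e0 \<in> proper_edges N" "(q \<le> u (?t e0)) \<noteq> (q \<le> u (?h e0))"
    by (rule connected_crossing_edge[OF N(2) ab(1,2), of "\<lambda>w. q \<le> u w"]) (use ab in auto)
  define v where "v = (if q \<le> u (?t e0) then ?t e0 else ?h e0)"
  have v: "v \<in> verts A"
    using e0 proper_edge_verts[OF N(1) e0(1)] by (auto simp: v_def A(4))
  \<comment> \<open>This is the contribution of \<open>e0\<close> to the pairing, since
    \<open>g\<close> will be 1 at \<open>v\<close> and 0 at the other end.\<close>
  define \<kappa> where "\<kappa> = \<bar>u (?h e0) - u (?t e0)\<bar> / res N e0"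
  have \<kappa>: "\<kappa> > 0"
    using e0(2) proper_edge_res_pos[OF N(1) e0(1)] by (auto simp: \<kappa>_def)
  have E: "?E \<ge> 0" by (rule l2_inner_self_nonneg)
  \<comment> \<open>This threshold times \<open>?E\<close> is below \<open>\<kappa>\<^sup>2\<close>;
    the summand 1 covers \<open>?E = 0\<close>.\<close>
  have "\<kappa>\<^sup>2 / (?E + 1) > 0" using \<kappa> E by simp
  then obtain f where f: "finitely_supported A f" "f v = 1"
    "l2_inner (proper_edges A) (norm_grad A f) (norm_grad A f) < \<kappa>\<^sup>2 / (?E + 1)"
    by (rule small_energy_of_not_transient[OF A(2,3) nt v])
  \<comment> \<open>Taking absolute values makes \<open>g\<close> nonnegative, which settles the
    sign on edges leaving \<open>?X\<close>, and does not increase differences. Outside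
    \<open>?X\<close> the values of \<open>f\<close> are unrestricted and are replaced by 0.\<close>
  define g where "g = (\<lambda>w. if w \<in> ?X then \<bar>f w\<bar> else 0)"
  have g: "finitely_supported N g"
    using f(1) unfolding finitely_supported_def
    by (rule finite_subset[rotated]) (auto simp: g_def A(4))
  have gl2: "l2_on (proper_edges N) (norm_grad N g)"
    by (rule l2_on_finitely_supported_grad[OF N(1,3) g])
  have fl2: "l2_on (proper_edges A) (norm_grad A f)"
    by (rule l2_on_finitely_supported_grad[OF A(2,3) f(1)])
  note sub = subnetwork_proper_edges[OF A(1)]
  have gA: "l2_on (proper_edges A) (norm_grad N g)" by (rule l2_on_subset[OF gl2 sub])
  let ?k = "\<lambda>e. norm_grad N u e * norm_grad N g e"
  have k_sum: "?k summable_on S" if "S \<subseteq> proper_edges N" for S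
    using that by (intro l2_on_mult_summable l2_on_subset[OF ul2] l2_on_subset[OF gl2])
  have k_eq: "?k e = (u (?h e) - u (?t e)) * (g (?h e) - g (?t e)) / res N e"
    if "e \<in> proper_edges N" for e
    using proper_edge_res_pos[OF N(1) that] by (simp add: norm_grad_def)
  \<comment> \<open>If one end lies in \<open>?X\<close>, both \<open>u\<close> and \<open>g\<close>
    are at least as large there as at the other end. If neither does, \<open>g\<close> vanishes at
    both.\<close>
  have k_nonneg: "?k e \<ge> 0" if e: "e \<in> proper_edges N - proper_edges A" for e
  proof -
    have "(u (?h e) - u (?t e)) * (g (?h e) - g (?t e)) \<ge> 0"
      using e peA[of e] proper_edge_verts[OF N(1), of e]
      by (auto simp: g_def mult_nonneg_nonneg mult_nonpos_nonpos mult_nonpos_nonneg)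
    with e proper_edge_res_pos[OF N(1), of e] show ?thesis
      by (simp add: k_eq)
  qed
  have k0: "?k e0 = \<kappa>"
    unfolding k_eq[OF e0(1)] using e0(2) f(2) proper_edge_verts[OF N(1) e0(1)]
    by (auto simp: \<kappa>_def g_def v_def split: if_splits)
  \<comment> \<open>The total pairing is zero and the edges outside \<open>A\<close> contribute at
    least \<open>\<kappa>\<close>, so those inside contribute at most
    \<open>- \<kappa>\<close>.\<close>
  have "0 = infsum ?k (proper_edges N)"
    using harmonic_orthogonal_finitely_supported[OF N(1,3) u(1) g] by (simp add: l2_inner_def)
  also have "\<dots> = infsum ?k (proper_edges A \<union> (proper_edges N - proper_edges A))"
    using sub by (simp add: Un_absorb1)
  also have "\<dots> = infsum ?k (proper_edges A) + infsum ?k (proper_edges N - proper_edges A)"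
    using sub by (intro infsum_Un_disjoint k_sum) auto
  finally have split: "0 = infsum ?k (proper_edges A) + infsum ?k (proper_edges N - proper_edges A)" .
  have "sum ?k {e0} \<le> infsum ?k (proper_edges N - proper_edges A)"
    using e0 peA k_nonneg by (intro finite_sum_le_infsum k_sum) auto
  with split k0 have "\<kappa> \<le> - infsum ?k (proper_edges A)" by simp
  then have "\<kappa>\<^sup>2 \<le> (infsum ?k (proper_edges A))\<^sup>2"
    using \<kappa> power_mono[of \<kappa> "- infsum ?k (proper_edges A)" 2] by simp
  also have "\<dots> \<le> ?E * l2_inner (proper_edges A) (norm_grad N g) (norm_grad N g)"
    using l2_Cauchy_Schwarz[OF l2_on_subset[OF ul2 sub] gA]
    by (simp add: l2_inner_def)
  also have "\<dots> \<le> ?E * l2_inner (proper_edges A) (norm_grad A f) (norm_grad A f)"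
  proof (rule mult_left_mono[OF _ E])
    show "l2_inner (proper_edges A) (norm_grad N g) (norm_grad N g)
        \<le> l2_inner (proper_edges A) (norm_grad A f) (norm_grad A f)"
      unfolding l2_inner_def
    proof (rule infsum_mono[OF l2_on_mult_summable[OF gA gA] l2_on_mult_summable[OF fl2 fl2]])
      fix e assume e: "e \<in> proper_edges A"
      then have "e \<in> proper_edges N" using sub by blast
      with e have "g (?t e) = \<bar>f (?t e)\<bar>" "g (?h e) = \<bar>f (?h e)\<bar>"
        using peA[of e] proper_edge_verts[OF N(1), of e] by (auto simp: g_def)
      then have "\<bar>g (?h e) - g (?t e)\<bar> \<le> \<bar>f (?h e) - f (?t e)\<bar>"
        by (simp add: abs_triangle_ineq3)
      then have "\<bar>norm_grad N g e\<bar> \<le> \<bar>norm_grad N f e\<bar>"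
        unfolding norm_grad_def abs_divide by (rule divide_right_mono) simp
      then have "\<bar>norm_grad N g e\<bar> \<le> \<bar>norm_grad A f e\<bar>"
        by (simp only: subnetwork_norm_grad[OF A(1) e])
      then show "norm_grad N g e * norm_grad N g e \<le> norm_grad A f e * norm_grad A f e"
        using abs_le_square_iff[of "norm_grad N g e"] by (simp add: power2_eq_square)
    qed
  qed
  also have "\<dots> \<le> ?E * (\<kappa>\<^sup>2 / (?E + 1))"
    using f(3) E by (intro mult_left_mono) auto
  also have "\<dots> < \<kappa>\<^sup>2"
    using \<kappa> E by (simp add: field_simps)
  finally show False by simp
qed


subsection \<open>Potentials on networks in \<open>O_HD\<close>\<close>

text \<open>A pointwise limit of gradients is a gradient: differences converge along edges, and
  hence along paths, which join any two vertices.\<close>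

lemma convergent_grad_imp_convergent_differences:
  assumes N: "is_network N" "connected_network N"
    and lim: "\<And>e. e \<in> proper_edges N \<Longrightarrow> (\<lambda>n. norm_grad N (g n) e) \<longlonglongrightarrow> x e"
  obtains u where "\<And>e. e \<in> proper_edges N \<Longrightarrow> norm_grad N u e = x e"
    "\<And>v w. v \<in> verts N \<Longrightarrow> w \<in> verts N \<Longrightarrow> (\<lambda>n. g n v - g n w) \<longlonglongrightarrow> u v - u w"
proof -
  let ?t = "\<lambda>e. init (orientation N e)" and ?h = "\<lambda>e. ter (orientation N e)"
  have edge: "(\<lambda>n. g n (?h e) - g n (?t e)) \<longlonglongrightarrow> x e * sqrt (res N e)"
    if e: "e \<in> proper_edges N" for e
    using tendsto_mult_right[OF lim[OF e], of "sqrt (res N e)"] proper_edge_res_pos[OF N(1) e]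
    by (simp add: norm_grad_def)
  have adj: "convergent (\<lambda>n. g n w - g n v)" if "(v, w) \<in> adjacency N" for v w
  proof -
    obtain e where e: "e \<in> edges N" "ends N e = Upair v w"
      using \<open>(v, w) \<in> adjacency N\<close> by (auto simp: adjacency_def)
    show ?thesis
    proof (cases "v = w")
      case True
      then show ?thesis by (simp add: convergent_const)
    next
      case False
      with e have pe: "e \<in> proper_edges N" by (simp add: proper_edges_def)
      have "w = ?h e \<and> v = ?t e \<or> w = ?t e \<and> v = ?h e"
        using proper_edge_ends(1)[OF pe] e(2) by auto
      moreover have "convergent (\<lambda>n. g n (?h e) - g n (?t e))"
        using edge[OF pe] by (rule convergentI)
      moreover have "convergent (\<lambda>n. g n (?t e) - g n (?h e))"
        using tendsto_minus[OF edge[OF pe]] by (intro convergentI) simp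
      ultimately show ?thesis by auto
    qed
  qed
  have path: "convergent (\<lambda>n. g n w - g n v)" if "(v, w) \<in> (adjacency N)\<^sup>*" for v w
    using that
  proof (induction rule: rtrancl_induct)
    case base
    show ?case by (simp add: convergent_const)
  next
    case (step y z)
    then show ?case
      using convergent_add[OF step.IH adj[OF step.hyps(2)]] by simp
  qed
  obtain r where r: "r \<in> verts N"
    using N(2) by (auto simp: connected_network_def)
  \<comment> \<open>Only differences are known to converge, so the limit is normalized to vanish at
    \<open>r\<close>.\<close>
  define u where "u = (\<lambda>w. lim (\<lambda>n. g n w - g n r))"
  have u: "(\<lambda>n. g n w - g n r) \<longlonglongrightarrow> u w" if "w \<in> verts N" for w
    using path[of r w] N(2) r that by (simp add: u_def connected_network_def convergent_LIMSEQ_iff)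
  have diff: "(\<lambda>n. g n v - g n w) \<longlonglongrightarrow> u v - u w" if "v \<in> verts N" "w \<in> verts N" for v w
    using tendsto_diff[OF u[OF that(1)] u[OF that(2)]] by simp
  have "norm_grad N u e = x e" if e: "e \<in> proper_edges N" for e
  proof -
    have "u (?h e) - u (?t e) = x e * sqrt (res N e)"
      using LIMSEQ_unique[OF diff edge[OF e]] proper_edge_verts[OF N(1) e] by simp
    then show ?thesis
      using proper_edge_res_pos[OF N(1) e] by (simp add: norm_grad_def)
  qed
  with diff show thesis by (intro that)
qed

lemma norm_grad_add_constant:
  assumes "is_network A" "\<And>w. w \<in> verts A \<Longrightarrow> h w = a" "e \<in> proper_edges A"
  shows "norm_grad A (\<lambda>w. h w + f w) e = norm_grad A f e"
  using assms(2) proper_edge_verts[OF assms(1,3)] by (simp add: norm_grad_def)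

text \<open>The vertex is the source of a flow witnessing transience. On \<open>A\<close> the
  functions \<open>h + f n\<close> and \<open>f n\<close> have the same gradient; its norm tends to
  zero, so its pairing with the flow, which equals \<open>f n v * I\<close>, does too.\<close>

lemma transient_subnetwork_tendsto:
  fixes N A :: "('v, 'e) network" and f :: "nat \<Rightarrow> 'v \<Rightarrow> real" and h :: "'v \<Rightarrow> real"
  assumes N: "is_network N" "locally_finite N" and A: "subnetwork A N" "transient A"
    and h: "\<And>w. w \<in> verts A \<Longrightarrow> h w = a" and f: "\<And>n. finitely_supported N (f n)"
    and l2: "\<And>n. l2_on (proper_edges N) (norm_grad N (\<lambda>w. h w + f n w))"
    and lim: "(\<lambda>n. l2_inner (proper_edges N) (norm_grad N (\<lambda>w. h w + f n w))
      (norm_grad N (\<lambda>w. h w + f n w))) \<longlonglongrightarrow> 0"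
  obtains v where "v \<in> verts A" "(\<lambda>n. h v + f n v) \<longlonglongrightarrow> a"
proof -
  obtain v I \<phi> where v: "v \<in> verts A" "I \<noteq> 0" "is_flow A v I \<phi>" "finite_flow_energy A \<phi>"
    using A(2) by (auto simp: transient_def)
  have netA: "is_network A" "locally_finite A"
    using A(1) subnetwork_locally_finite[OF A(1) N(2)] by (auto simp: subnetwork_def)
  let ?S = "proper_edges A"
  note sub = subnetwork_proper_edges[OF A(1)]
  have grad: "norm_grad A (f n) e = norm_grad N (\<lambda>w. h w + f n w) e" if "e \<in> ?S" for n e
    using subnetwork_norm_grad[OF A(1) that, of "\<lambda>w. h w + f n w"]
      norm_grad_add_constant[OF netA(1) h that, where f = "f n"] by simp
  have gl2: "l2_on ?S (norm_grad A (f n))" for n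
    using l2_on_subset[OF l2 sub, of n]
    by (subst l2_on_cong[where x' = "norm_grad N (\<lambda>w. h w + f n w)"]) (simp_all add: grad)
  have "(\<lambda>n. l2_inner ?S (norm_grad A (f n)) (norm_grad A (f n))) \<longlonglongrightarrow> 0"
  proof (rule tendsto_sandwich[OF _ _ tendsto_const lim])
    show "\<forall>\<^sub>F n in sequentially. 0 \<le> l2_inner ?S (norm_grad A (f n)) (norm_grad A (f n))"
      by (simp add: l2_inner_self_nonneg)
    have "l2_inner ?S (norm_grad A (f n)) (norm_grad A (f n))
      \<le> l2_inner (proper_edges N) (norm_grad N (\<lambda>w. h w + f n w)) (norm_grad N (\<lambda>w. h w + f n w))" for n
      unfolding l2_inner_def
      by (rule infsum_mono_neutral[OF l2_on_mult_summable[OF gl2 gl2] l2_on_mult_summable[OF l2 l2]])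
        (use grad sub in auto)
    then show "\<forall>\<^sub>F n in sequentially. l2_inner ?S (norm_grad A (f n)) (norm_grad A (f n))
      \<le> l2_inner (proper_edges N) (norm_grad N (\<lambda>w. h w + f n w)) (norm_grad N (\<lambda>w. h w + f n w))"
      by simp
  qed
  moreover have "l2_on ?S (\<lambda>_. 0)" "l2_inner ?S y (\<lambda>_. 0) = 0" for y
    by (simp_all add: l2_on_def l2_inner_def)
  moreover have "l2_on ?S (norm_flow A \<phi>)"
    using v(4) finite_flow_energy_iff_l2_on[OF netA(1)] by blast
  ultimately have "(\<lambda>n. l2_inner ?S (norm_flow A \<phi>) (norm_grad A (f n))) \<longlonglongrightarrow> 0"
    using l2_inner_tendsto[of ?S "\<lambda>n. norm_grad A (f n)" "\<lambda>_. 0" "norm_flow A \<phi>"] gl2 by simp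
  moreover have "l2_inner ?S (norm_flow A \<phi>) (norm_grad A (f n)) = f n v * I" for n
  proof -
    \<comment> \<open>Inserting \<open>v\<close> keeps the source in the sum even when
      \<open>f n v = 0\<close>.\<close>
    let ?F = "insert v {w \<in> verts A. f n w \<noteq> 0}"
    have fin: "finite ?F"
      using f[of n] A(1) unfolding finitely_supported_def subnetwork_def
      by (auto elim!: rev_finite_subset)
    have "l2_inner ?S (norm_flow A \<phi>) (norm_grad A (f n)) = (\<Sum>w\<in>?F. f n w * accumulation A \<phi> w)"
      using v(1,3) fin by (intro l2_inner_flow_grad netA) (auto simp: is_flow_def)
    also have "\<dots> = (\<Sum>w\<in>{v}. f n w * accumulation A \<phi> w)"
      using v(1,3) fin by (intro sum.mono_neutral_right) (auto simp: is_flow_def K1_def)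
    finally show ?thesis using v(3) by (simp add: is_flow_def)
  qed
  ultimately have "(\<lambda>n. f n v * I) \<longlonglongrightarrow> 0" by simp
  then have "(\<lambda>n. f n v) \<longlonglongrightarrow> 0"
    using v(2) tendsto_mult_right[of "\<lambda>n. f n v * I" 0 sequentially "inverse I"] by simp
  then have "(\<lambda>n. h v + f n v) \<longlonglongrightarrow> a"
    using tendsto_add[OF tendsto_const[of a]] h[OF v(1)] by fastforce
  with v(1) show thesis by (rule that)
qed

text \<open>The gradients of \<open>h + f n\<close> converge to the projection \<open>x\<close> of
  the gradient of \<open>h\<close>. As their pointwise limit, \<open>x\<close> is the gradient of
  some \<open>u\<close>; this \<open>u\<close> is harmonic of finite energy, hence constant, so
  \<open>x\<close> vanishes and the distance to \<open>x\<close> is the energy itself.\<close>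

lemma O_HD_approximation:
  assumes N: "is_network N" "connected_network N" "locally_finite N" "O_HD N"
    and h: "finite_potential_energy N h"
  obtains f where "\<And>n. finitely_supported N (f n)"
    "\<And>n. l2_on (proper_edges N) (norm_grad N (\<lambda>w. h w + f n w))"
    "(\<lambda>n. l2_inner (proper_edges N) (norm_grad N (\<lambda>w. h w + f n w))
      (norm_grad N (\<lambda>w. h w + f n w))) \<longlonglongrightarrow> 0"
    "\<And>v w. v \<in> verts N \<Longrightarrow> w \<in> verts N \<Longrightarrow>
      (\<lambda>n. (h v + f n v) - (h w + f n w)) \<longlonglongrightarrow> 0"
proof -
  let ?S = "proper_edges N"
  let ?V = "norm_grad N ` Collect (finitely_supported N)"
  have hl2: "l2_on ?S (norm_grad N h)"
    using h finite_potential_energy_iff_l2_on[OF N(1)] by blast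
  have Vl2: "l2_on ?S w" if "w \<in> ?V" for w
    using that l2_on_finitely_supported_grad[OF N(1,3)] by blast
  obtain x k where x: "l2_on ?S x" and k: "\<And>n. k n \<in> ?V"
    and orth: "\<And>w. w \<in> ?V \<Longrightarrow> l2_inner ?S x w = 0"
    and ptw: "\<And>e. e \<in> ?S \<Longrightarrow> (\<lambda>n. norm_grad N h e + k n e) \<longlonglongrightarrow> x e"
    and lim: "(\<lambda>n. l2_inner ?S (\<lambda>e. norm_grad N h e + k n e - x e)
        (\<lambda>e. norm_grad N h e + k n e - x e)) \<longlonglongrightarrow> 0"
  proof (rule l2_projection[OF hl2, of ?V])
    show "?V \<noteq> {}" using finitely_supported_indicator[of N] by blast
    show "(\<lambda>e. a * w e + b * w' e) \<in> ?V" if ww: "w \<in> ?V" "w' \<in> ?V" for w w' a b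
    proof -
      obtain f g where fg: "finitely_supported N f" "finitely_supported N g"
        "w = norm_grad N f" "w' = norm_grad N g"
        using ww by auto
      then show ?thesis
        by (intro image_eqI[of _ _ "\<lambda>u. a * f u + b * g u"])
          (simp_all add: norm_grad_lincomb finitely_supported_lincomb)
    qed
  qed (use Vl2 in blast)+
  from k obtain f where f: "\<And>n. finitely_supported N (f n)" "\<And>n. k n = norm_grad N (f n)"
    unfolding image_iff Bex_def mem_Collect_eq by metis
  have grad: "norm_grad N (\<lambda>w. h w + f n w) = (\<lambda>e. norm_grad N h e + k n e)" for n
    using norm_grad_lincomb[of N 1 h 1 "f n"] f(2) by simp
  obtain u where u: "\<And>e. e \<in> ?S \<Longrightarrow> norm_grad N u e = x e"
    "\<And>v w. v \<in> verts N \<Longrightarrow> w \<in> verts N \<Longrightarrow>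
      (\<lambda>n. (h v + f n v) - (h w + f n w)) \<longlonglongrightarrow> u v - u w"
    by (rule convergent_grad_imp_convergent_differences[OF N(1,2), of "\<lambda>n w. h w + f n w" x])
      (use ptw grad in auto)
  \<comment> \<open>Point indicators are finitely supported, so orthogonality of \<open>x\<close> to
    their gradients makes \<open>u\<close> harmonic.\<close>
  have "accumulation N (grad_flow N u) v = 0" if v: "v \<in> verts N" for v
  proof -
    have "accumulation N (grad_flow N u) v = l2_inner ?S x (norm_grad N (\<lambda>w. of_bool (w = v)))"
      unfolding accumulation_eq_l2_inner[OF N(1,3) antisymmetric_grad_flow v]
      by (rule l2_inner_cong) (simp_all add: norm_flow_grad_flow[OF N(1)] u(1))
    also have "\<dots> = 0"
      by (intro orth imageI) (simp add: finitely_supported_indicator)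
    finally show ?thesis .
  qed
  then have "harmonic N u" by (simp add: harmonic_iff_accumulation)
  moreover have "finite_potential_energy N u"
    unfolding finite_potential_energy_iff_l2_on[OF N(1)]
    using x l2_on_cong[of ?S "norm_grad N u" x] u(1) by simp
  ultimately obtain c where c: "\<And>v. v \<in> verts N \<Longrightarrow> u v = c"
    using N(4) unfolding O_HD_def by blast
  have x0: "x e = 0" if e: "e \<in> ?S" for e
    using u(1)[OF e] c proper_edge_verts[OF N(1) e] by (simp add: norm_grad_def)
  have energy: "l2_inner ?S (norm_grad N (\<lambda>w. h w + f n w)) (norm_grad N (\<lambda>w. h w + f n w))
      = l2_inner ?S (\<lambda>e. norm_grad N h e + k n e - x e) (\<lambda>e. norm_grad N h e + k n e - x e)" for n
    by (rule l2_inner_cong) (simp_all add: grad x0)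
  show thesis
  proof (rule that)
    show "finitely_supported N (f n)" for n by (rule f)
    show "l2_on ?S (norm_grad N (\<lambda>w. h w + f n w))" for n
      unfolding grad by (intro l2_on_add hl2 Vl2 k)
    show "(\<lambda>n. l2_inner ?S (norm_grad N (\<lambda>w. h w + f n w)) (norm_grad N (\<lambda>w. h w + f n w)))
        \<longlonglongrightarrow> 0"
      unfolding energy by (rule lim)
    show "(\<lambda>n. (h v + f n v) - (h w + f n w)) \<longlonglongrightarrow> 0"
      if "v \<in> verts N" "w \<in> verts N" for v w
      using u(2)[OF that] c[OF that(1)] c[OF that(2)] by simp
  qed
qed

text \<open>One approximating sequence serves both subnetworks: it tends to \<open>a\<close> at a
  vertex of \<open>A\<close> and to \<open>b\<close> at a vertex of \<open>B\<close>, while its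
  difference between these vertices tends to zero.\<close>

lemma O_HD_constant_on_transient_eq:
  assumes N: "is_network N" "connected_network N" "locally_finite N" "O_HD N"
    and h: "finite_potential_energy N h"
    and A: "subnetwork A N" "transient A" "\<And>w. w \<in> verts A \<Longrightarrow> h w = a"
    and B: "subnetwork B N" "transient B" "\<And>w. w \<in> verts B \<Longrightarrow> h w = b"
  shows "a = b"
proof -
  obtain f where f: "\<And>n. finitely_supported N (f n)"
    "\<And>n. l2_on (proper_edges N) (norm_grad N (\<lambda>w. h w + f n w))"
    "(\<lambda>n. l2_inner (proper_edges N) (norm_grad N (\<lambda>w. h w + f n w))
      (norm_grad N (\<lambda>w. h w + f n w))) \<longlonglongrightarrow> 0"
    and diff: "\<And>v w. v \<in> verts N \<Longrightarrow> w \<in> verts N \<Longrightarrow>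
      (\<lambda>n. (h v + f n v) - (h w + f n w)) \<longlonglongrightarrow> 0"
    using O_HD_approximation[OF N h] by blast
  obtain v where v: "v \<in> verts A" "(\<lambda>n. h v + f n v) \<longlonglongrightarrow> a"
    by (rule transient_subnetwork_tendsto[OF N(1,3) A f])
  obtain w where w: "w \<in> verts B" "(\<lambda>n. h w + f n w) \<longlonglongrightarrow> b"
    by (rule transient_subnetwork_tendsto[OF N(1,3) B f])
  have "v \<in> verts N" "w \<in> verts N"
    using v(1) w(1) A(1) B(1) by (auto simp: subnetwork_def)
  from diff[OF this] tendsto_diff[OF v(2) w(2)] have "a - b = 0"
    by (rule LIMSEQ_unique[symmetric])
  then show ?thesis by simp
qed

section \<open>Level sets, clamping and the equivalence\<close>

text \<open>Negation turns sublevel sets into superlevel sets, so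
  \<open>transient_superlevel\<close> covers both.\<close>

lemma harmonic_uminus: "harmonic N u \<Longrightarrow> harmonic N (\<lambda>w. - u w)"
proof -
  assume u: "harmonic N u"
  have "(\<Sum>d | d \<in> dedges N \<and> init d = v. conductance N (fst d) * (- u v - - u (ter d)))
    = - (\<Sum>d | d \<in> dedges N \<and> init d = v. conductance N (fst d) * (u v - u (ter d)))" for v
    by (simp add: sum_negf[symmetric] algebra_simps)
  with u show ?thesis by (simp add: harmonic_def)
qed

text \<open>Serves for negation and for clamping, neither of which increases differences.\<close>

lemma finite_potential_energy_le:
  assumes N: "is_network N" "finite_potential_energy N h"
    and le: "\<And>v w. \<bar>g v - g w\<bar> \<le> \<bar>h v - h w\<bar>"
  shows "finite_potential_energy N g"
  unfolding finite_potential_energy_def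
proof (rule summable_on_comparison_test)
  show "(\<lambda>e. sq_drop h (ends N e) / res N e) summable_on edges N"
    using N(2) by (simp add: finite_potential_energy_def)
  fix e assume "e \<in> edges N"
  then have pos: "res N e \<ge> 0" using N(1) by (auto simp: is_network_def less_imp_le)
  have le: "sq_drop g p \<le> sq_drop h p" "0 \<le> sq_drop g p" for p
    using le by (cases p; simp add: abs_le_square_iff)+
  show "sq_drop g (ends N e) / res N e \<le> sq_drop h (ends N e) / res N e"
    "0 \<le> sq_drop g (ends N e) / res N e"
    using pos le by (auto intro: divide_right_mono divide_nonneg_nonneg)
qed

theorem theorem1p1:
  fixes N :: "('v, 'e) network"
  assumes "is_network N"
    and "connected_network N"
    and "locally_finite N"
  shows "\<not> O_HD N \<longleftrightarrow>
    (\<exists>A B. subnetwork A N \<and> subnetwork B N \<and> verts A \<inter> verts B = {} \<and>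
       transient A \<and> transient B \<and>
       (\<exists>\<rho>. finite_potential_energy (contraction N A B) \<rho> \<and> \<rho> (verts A) \<noteq> \<rho> (verts B)))"
    (is "_ \<longleftrightarrow> ?separated")
proof
  assume "\<not> O_HD N"
  then obtain u where u: "harmonic N u" "finite_potential_energy N u"
    and nonconst: "\<And>c. \<exists>v\<in>verts N. u v \<noteq> c"
    unfolding O_HD_def by blast
  obtain v where v: "v \<in> verts N" using nonconst by blast
  obtain w where w: "w \<in> verts N" "u w \<noteq> u v" using nonconst by blast
  obtain a b where ab: "a \<in> verts N" "b \<in> verts N" "u a < u b"
    using v w by (meson linorder_neqE_linordered_idom)
  define A where "A = induced N {x \<in> verts N. u b \<le> u x}"
  define B where "B = induced N {x \<in> verts N. - u a \<le> - u x}"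
  have B_energy: "finite_potential_energy N (\<lambda>x. - u x)"
    by (rule finite_potential_energy_le[OF assms(1) u(2)]) linarith
  have "subnetwork A N" "subnetwork B N"
    unfolding A_def B_def by (intro subnetwork_induced[OF assms(1)]; blast)+
  moreover have "verts A \<inter> verts B = {}"
    using ab by (auto simp: A_def B_def)
  moreover have "transient A"
    unfolding A_def by (rule transient_superlevel[OF assms u ab(2,1)]) (use ab in auto)
  moreover have "transient B"
    unfolding B_def
    by (rule transient_superlevel[OF assms harmonic_uminus[OF u(1)] B_energy ab(1,2)]) (use ab in auto)
  moreover define g where "g = (\<lambda>x. min (max (u x) (u a)) (u b))"
  \<comment> \<open>\<open>SOME\<close> picks a representative of a contracted vertex: the element
    of a singleton, or any vertex of \<open>A\<close> or of \<open>B\<close>, where \<open>g\<close>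
    is constant.\<close>
  define \<rho> where "\<rho> = (\<lambda>X. g (SOME x. x \<in> X))"
  have \<rho>A: "\<rho> (verts A) = u b"
  proof -
    have "(SOME x. x \<in> verts A) \<in> verts A"
      unfolding some_in_eq using ab(2) by (auto simp: A_def)
    then show ?thesis using ab(3) by (simp add: \<rho>_def g_def A_def)
  qed
  have \<rho>B: "\<rho> (verts B) = u a"
  proof -
    have "(SOME x. x \<in> verts B) \<in> verts B"
      unfolding some_in_eq using ab(1) by (auto simp: B_def)
    then show ?thesis using ab(3) by (simp add: \<rho>_def g_def B_def)
  qed
  have "(\<rho> \<circ> contract_vertex A B) x = g x" for x
    using \<rho>A \<rho>B ab(3)
    by (cases "x \<in> verts A"; cases "x \<in> verts B")
      (auto simp: contract_vertex_def g_def A_def B_def \<rho>_def)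
  then have \<rho>_g: "\<rho> \<circ> contract_vertex A B = g" by (rule ext)
  have "finite_potential_energy N g"
    by (rule finite_potential_energy_le[OF assms(1) u(2)]) (auto simp: g_def)
  then have "finite_potential_energy (contraction N A B) \<rho>"
    unfolding finite_potential_energy_contraction \<rho>_g .
  moreover have "\<rho> (verts A) \<noteq> \<rho> (verts B)"
    using \<rho>A \<rho>B ab(3) by simp
  ultimately show ?separated by blast
next
  assume ?separated
  then obtain A B \<rho> where AB: "subnetwork A N" "subnetwork B N" "verts A \<inter> verts B = {}"
    "transient A" "transient B"
    and \<rho>: "finite_potential_energy N (\<rho> \<circ> contract_vertex A B)" "\<rho> (verts A) \<noteq> \<rho> (verts B)"
    unfolding finite_potential_energy_contraction by blast
  show "\<not> O_HD N"
  proof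
    assume "O_HD N"
    have "\<rho> (verts A) = \<rho> (verts B)"
    proof (rule O_HD_constant_on_transient_eq[OF assms \<open>O_HD N\<close> \<rho>(1) AB(1,4) _ AB(2,5)])
      show "(\<rho> \<circ> contract_vertex A B) x = \<rho> (verts A)" if "x \<in> verts A" for x
        using that by (simp add: contract_vertex_def)
      \<comment> \<open>\<open>contract_vertex\<close> tests membership in \<open>A\<close> first;
        disjointness ensures that vertices of \<open>B\<close> go to \<open>verts B\<close>.\<close>
      show "(\<rho> \<circ> contract_vertex A B) x = \<rho> (verts B)" if "x \<in> verts B" for x
        using that AB(3) by (auto simp: contract_vertex_def)
    qed
    with \<rho>(2) show False by blast
  qed
qed

end
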